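(* The three bisimulation equivalences over $TCCS^m$ processes coincide: $(\approx_{\mathsf{Hasco}})=(\approx_{\mathsf{Eq}})=(\approx_{\mathsf{Canco}})$ as relations on processes.
   Context: LANGUAGE. $\mathsf{Act}$ is an infinite set of actions with CCS complementation ($\bar{\bar a}=a$); $\tau\notin\mathsf{Act}$; $\mu$ ranges over $\mathsf{Act}\cup\{\tau\}$. Transaction names: $\mathsf{TrN}=\mathsf{inTrN}\uplus\mathsf{exTrN}$ (internal and external names, both infinite). Terms: $P,Q::=\sum_{i\in J}\mu_i.P_i$ ($J$ countable; $\mathbf 0$ is the empty sum) $\mid P\mid Q\mid\nu a.P\mid X\mid\mathrm{rec}X.P\mid[\![P\triangleright_kQ]\!]$ (running transaction named $k$) $\mid\mathrm{co}\mid[\![P\blacktriangleright Q]\!]$ (dormant transaction). $ftn(o)$ is the set of transaction names in $o$; $o\,\sharp\,o'$ means no transaction name of $o$ occurs in $o'$. A process is a well-formed term: (1) it is closed (no free process variables); (2) $ftn$ of it is finite; and for all subterms $[\![P_1\triangleright_kP_1']\!]$, $[\![P_2\blacktriangleright P_2']\!]$, $\sum\mu_i.Q_i$, $\mathrm{rec}X.R$: (3) $P_1,P_1',P_2,P_2',Q_i,R$ contain no transaction names; (4) $P_1,P_2,Q_i$ contain no dormant transactions; (5) $P_1,P_2$ are closed. PROCESS TRANSITIONS. $P\xrightarrow{\alpha}_\sigma Q$ with $\alpha\in\{a,\tau,k(\tau),k(a)\}$ and $\sigma$ a name substitution $\tilde k\mapsto l$ (domain the finite tuple $\tilde k$, possibly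 empty, range $\{l\}$; $\varepsilon$ alone is the empty substitution). Rules (symmetric ones omitted): - $\sum\mu_i.P_i\xrightarrow{\mu_j}_\varepsilon P_j$; - if $P\xrightarrow{a}_\varepsilon P'$ and $Q\xrightarrow{\bar a}_\varepsilon Q'$ then $P\mid Q\xrightarrow{\tau}_\varepsilon P'\mid Q'$; - $\mathrm{rec}X.P\xrightarrow{\tau}_\varepsilon P[\mathrm{rec}X.P/X]$; - if $\mu_j=a$ then $\sum\mu_i.P_i\xrightarrow{k(a)}_{\varepsilon\mapsto k}[\![P_j\mid\mathrm{co}\triangleright_k\sum\mu_i.P_i]\!]$; - if $P\xrightarrow{\mu}_\varepsilon P'$ and $k\,\sharp\,l$ then $[\![P\triangleright_lQ]\!]\xrightarrow{k(\mu)}_{l\mapsto k}[\![P'\triangleright_kQ]\!]$; - if $P\xrightarrow{k(a)}_{\sigma_1}P'$, $Q\xrightarrow{k(\bar a)}_{\sigma_2}Q'$, $\sigma_i=\tilde l_i\mapsto k$, then $P\mid Q\xrightarrow{k(\tau)}_{(\tilde l_1,\tilde l_2)\mapsto k}P'\sigma_2\mid Q'\sigma_1$; - if $P\xrightarrow{\alpha}_\sigma P'$ and $range(\sigma)\,\sharp\,Q$ then $P\mid Q\xrightarrow{\alpha}_\sigma P'\mid Q\sigma$; - if $P\xrightarrow{\alpha}_\sigma P'$ and $a$ does not occur in $\alpha$ then $\nu a.P\xrightarrow{\alpha}_\sigma\nu a.P'$. Reconfiguration transitions $P\xrightarrow{\beta}Q$, $\beta\in\{\mathrm{co}\,k,\mathrm{ab}\,k,\mathrm{new}\,k\}$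 (symmetric rules omitted): - if $P\equiv\mathrm{co}\mid P''$ for some $P''$ and $P\rightsquigarrow_{\mathrm{co}}P'$ then $[\![P\triangleright_kQ]\!]\xrightarrow{\mathrm{co}\,k}P'$; - $[\![P\blacktriangleright Q]\!]\xrightarrow{\mathrm{new}\,k}[\![P\triangleright_kQ]\!]$; - $[\![P\triangleright_kQ]\!]\xrightarrow{\mathrm{ab}\,k}Q$; - for $\beta=\mathrm{co}\,k$ or $\mathrm{ab}\,k$: if $P\xrightarrow{\beta}P'$ and $Q\xrightarrow{\beta}Q'$ then $P\mid Q\xrightarrow{\beta}P'\mid Q'$; - if $P\xrightarrow{\beta}P'$ and $\beta\,\sharp\,Q$ then $P\mid Q\xrightarrow{\beta}P'\mid Q$; - if $P\xrightarrow{\beta}P'$ then $\nu a.P\xrightarrow{\beta}\nu a.P'$. Here $\equiv$ is standard CCS structural equivalence extended to transactions, and $\rightsquigarrow_{\mathrm{co}}$ is given by: $\mathrm{co}\rightsquigarrow_{\mathrm{co}}\mathbf 0$; sums, variables, $\mathrm{rec}X.P$ and $[\![P\blacktriangleright Q]\!]$ are related to themselves; it is compatible with $\nu a.-$ and $-\mid-$. EXTENDED CONFIGURATIONS. $I$ is a countable index set. An extended configuration is $\langle E;H\bullet P\rangle$ with $P$ a process, $E$ an equivalence relation over a finite subset of $\mathsf{TrN}$, and $H$ a finite partial function from $I$ to $\{k(a),k(\mathrm{ab}),k(\mathrm{co})\mid k\in\mathsf{exTrN},a\in\mathsf{Act}\}$. Let $H^{\mathrm{trn}}(i)$ be the name used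 in $H(i)$, $H^{\mathrm{trn}}$ the set of all these, and $\mathrm{Hasco}(H)=\{k\mid\exists i.\,H(i)=k(\mathrm{co})\}$. It is required that: (i) $H^{\mathrm{trn}}(i)=H^{\mathrm{trn}}(j)$ implies $i=j$; (ii) for $k\in\mathsf{exTrN}$, $k\,E\,k$ iff $k\in H^{\mathrm{trn}}$, and $k\,E\,k'$ implies ($k\in\mathrm{Hasco}(H)$ iff $k'\in\mathrm{Hasco}(H)$); (iii) $ftn(P)\cap\mathrm{Hasco}(H)=\emptyset$; (iv) $k\,E\,k'$ and $k,k'\in ftn(P)$ imply $k=k'$. Convention: external names of a configuration are those in its history, i.e. $ftn(P)\cap\mathsf{exTrN}\subseteq H^{\mathrm{trn}}$; in particular a process $P$ viewed as $\langle\emptyset;\varepsilon\bullet P\rangle$ ($\varepsilon$ the empty history) has $ftn(P)\subseteq\mathsf{inTrN}$. "$H,k(a)$" denotes $H$ extended at a new index. For $\sigma=\tilde k\mapsto l$, $\sigma(E)$ is the smallest equivalence relation $F\supseteq E$ with $l\,F\,l$ and $k\,F\,l$ for all $k\in dom(\sigma)$. $(E;H)\setminus_{\mathrm{co}}k$ (resp. $\setminus_{\mathrm{ab}}k$) keeps $E$ and, for every $k'\,E\,k$, changes each $k'(a)$ in $H$ to $k'(\mathrm{co})$ (resp. $k'(\mathrm{ab})$). With $\Delta=E;H$, the extended transitions between extended configurations are: - $\langle\Delta\bullet P\rangle\xrightarrow{\tau}_e\langle\Delta\bullet Q\rangle$ if $P\xrightarrow{\tau}_\varepsilon Q$; - $\xrightarrow{\tau}_e\langle\sigma(E);H\bullet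 Q\rangle$ if $P\xrightarrow{k(\tau)}_\sigma Q$, $k\,\sharp\,E,H$, $k\in\mathsf{inTrN}$; - $\xrightarrow{\tau}_e\langle\Delta\bullet Q\rangle$ if $P\xrightarrow{\mathrm{new}\,k}Q$, $k\,\sharp\,\Delta$, $k\in\mathsf{inTrN}$; - $\xrightarrow{\tau}_e\langle\Delta\setminus_{\mathrm{co}}k\bullet Q\rangle$ if $P\xrightarrow{\mathrm{co}\,k}Q$; - $\xrightarrow{\tau}_e\langle\Delta\setminus_{\mathrm{ab}}k\bullet Q\rangle$ if $P\xrightarrow{\mathrm{ab}\,k}Q$; - $\xrightarrow{k(a)}_e\langle\sigma(E);H,k(a)\bullet Q\rangle$ if $P\xrightarrow{k(a)}_\sigma Q$, $k\,\sharp\,E,H$, $k\in\mathsf{exTrN}$; - $\xrightarrow{k(a)}_e\langle E,(k,k);H,k(\mathrm{ab})\bullet P\rangle$ if $k\,\sharp\,E,H,P$, $k\in\mathsf{exTrN}$. The commit-sensitive transitions $\xrightarrow{\zeta}_c$ are given by the same rules (with $_c$ for $_e$), except that the commit rule is replaced, with $E_{ext}(k)=\{k'\in\mathsf{exTrN}\mid k\,E\,k'\}$, by: $\langle\Delta\bullet P\rangle\xrightarrow{\mathrm{co}(E_{ext}(k))}_c\langle\Delta\setminus_{\mathrm{co}}k\bullet Q\rangle$ if $P\xrightarrow{\mathrm{co}\,k}Q$ and $E_{ext}(k)\neq\emptyset$; and $\langle\Delta\bullet P\rangle\xrightarrow{\tau}_c\langle\Delta\setminus_{\mathrm{co}}k\bullet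 Q\rangle$ if $P\xrightarrow{\mathrm{co}\,k}Q$ and $E_{ext}(k)=\emptyset$. For $s\in\{e,c\}$, $\stackrel{\tau}{\Rightarrow}_s$ is $(\xrightarrow{\tau}_s)^*$ and $\stackrel{\zeta}{\Rightarrow}_s$ is $\stackrel{\tau}{\Rightarrow}_s\xrightarrow{\zeta}_s\stackrel{\tau}{\Rightarrow}_s$ otherwise. BISIMULATIONS. For a relation $\mathcal R$ on extended configurations, the $s$-transfer property ($s\in\{e,c\}$) says: whenever $\mathcal C_1\mathcal R\mathcal C_2$, for every $\zeta\in\{\tau,k(a)\}$, if $\mathcal C_1\stackrel{\zeta}{\Rightarrow}_s\mathcal C_1'$ with $\zeta\,\sharp\,\mathcal C_2$ then $\mathcal C_2\stackrel{\zeta}{\Rightarrow}_s\mathcal C_2'$ for some $\mathcal C_2'$ with $\mathcal C_1'\mathcal R\mathcal C_2'$; and conversely. - $\mathcal R$ is a $\mathsf{Hasco}$-bisimulation if it has the $e$-transfer property and $\mathcal C_1\mathcal R\mathcal C_2$ implies $\mathrm{Hasco}(\mathcal C_1)=\mathrm{Hasco}(\mathcal C_2)$ (the $\mathrm{Hasco}$ sets of their histories). - $\mathcal R$ is an $\mathsf{Eq}$-bisimulation if it has the $e$-transfer property and $\mathcal C_1\mathcal R\mathcal C_2$ implies that for all $k,k'\in\mathsf{exTrN}$, $\mathcal C_1\models k=_{\mathrm{co}}k'$ iff $\mathcal C_2\models k=_{\mathrm{co}}k'$, where $\langle E;H\bullet P\rangle\models k=_{\mathrm{co}}k'$ means $k,k'\in\mathrm{Hasco}(H)$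 and $k\,E\,k'$. - $\mathcal R$ is a commit-sensitive bisimulation if it has the $c$-transfer property and, whenever $\mathcal C_1\mathcal R\mathcal C_2$, for all $K\subseteq\mathsf{exTrN}$, if $\mathcal C_1\stackrel{\mathrm{co}(K)}{\Rightarrow}_c\mathcal C_1'$ then $\mathcal C_2\stackrel{\mathrm{co}(K)}{\Rightarrow}_c\mathcal C_2'$ for some $\mathcal C_2'$ with $\mathcal C_1'\mathcal R\mathcal C_2'$, and conversely. $\approx_{\mathsf{Hasco}},\approx_{\mathsf{Eq}},\approx_{\mathsf{Canco}}$ are respectively the largest $\mathsf{Hasco}$-, $\mathsf{Eq}$- and commit-sensitive bisimulations; each is extended to processes by relating $P$ and $Q$ iff $\langle\emptyset;\varepsilon\bullet P\rangle$ and $\langle\emptyset;\varepsilon\bullet Q\rangle$ are related. *)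

theory Defs
  imports Main
begin

section \<open>Syntax\<close>

text \<open>
  Terms are represented up to alpha-conversion by de Bruijn indices, separately for process
  variables (bound by \<open>Rec\<close>) and for restricted names (bound by \<open>Res\<close>).  A channel name is either
  a genuine name \<open>Fr a\<close> or an index \<open>Bd i\<close> pointing to the \<open>i\<close>-th enclosing restriction.  Thus
  \<open>'n act\<close> (the names \<open>'n\<close> and their co-names) is the set of actions of the calculus, whereas the
  actions inside terms live in \<open>'n chan act\<close>.
\<close>

datatype 'n chan = Fr 'n | Bd nat

datatype 'c act = Nm 'c | CoNm 'c

primrec compl :: "'c act \<Rightarrow> 'c act" where
  "compl (Nm c) = CoNm c"
| "compl (CoNm c) = Nm c"

datatype 'c pre = Tau | Vis "'c act"

datatype ('i, 'e) trn = InT 'i | ExT 'e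

text \<open>
  The partial function in \<open>Choice\<close> is the countable family of summands; its domain is the index
  set.  \<open>Run P k Q\<close> is the running transaction with body \<open>P\<close>, name \<open>k\<close> and alternative \<open>Q\<close>, and
  \<open>Dorm P Q\<close> is the dormant one.  Transaction names have no binders, so the set function \<open>ftn\<close> of
  the datatype collects the transaction names of a term and its map function renames them.
\<close>

datatype (chn: 'n, ftn: 't) tm =
    Choice "nat \<Rightarrow> ('n chan pre \<times> ('n, 't) tm) option"
  | Par "('n, 't) tm" "('n, 't) tm"
  | Res "('n, 't) tm"
  | Var nat
  | Rec "('n, 't) tm"
  | Run "('n, 't) tm" 't "('n, 't) tm"
  | Co
  | Dorm "('n, 't) tm" "('n, 't) tm"

abbreviation Nil0 :: "('n, 't) tm" where
  "Nil0 \<equiv> Choice (\<lambda>_. None)"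

text \<open>Renaming of restriction indices and of variable indices.\<close>

primrec ren_chan :: "(nat \<Rightarrow> nat) \<Rightarrow> 'n chan \<Rightarrow> 'n chan" where
  "ren_chan \<rho> (Fr a) = Fr a"
| "ren_chan \<rho> (Bd i) = Bd (\<rho> i)"

definition up :: "(nat \<Rightarrow> nat) \<Rightarrow> nat \<Rightarrow> nat" where
  "up \<rho> i = (case i of 0 \<Rightarrow> 0 | Suc j \<Rightarrow> Suc (\<rho> j))"

primrec nren :: "(nat \<Rightarrow> nat) \<Rightarrow> ('n, 't) tm \<Rightarrow> ('n, 't) tm" where
  "nren \<rho> (Choice f) =
     Choice (\<lambda>i. map_option (map_prod (map_pre (ren_chan \<rho>)) (nren \<rho>)) (f i))"
| "nren \<rho> (Par P Q) = Par (nren \<rho> P) (nren \<rho> Q)"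
| "nren \<rho> (Res P) = Res (nren (up \<rho>) P)"
| "nren \<rho> (Var X) = Var X"
| "nren \<rho> (Rec P) = Rec (nren \<rho> P)"
| "nren \<rho> (Run P k Q) = Run (nren \<rho> P) k (nren \<rho> Q)"
| "nren \<rho> Co = Co"
| "nren \<rho> (Dorm P Q) = Dorm (nren \<rho> P) (nren \<rho> Q)"

primrec vren :: "(nat \<Rightarrow> nat) \<Rightarrow> ('n, 't) tm \<Rightarrow> ('n, 't) tm" where
  "vren \<rho> (Choice f) = Choice (\<lambda>i. map_option (map_prod id (vren \<rho>)) (f i))"
| "vren \<rho> (Par P Q) = Par (vren \<rho> P) (vren \<rho> Q)"
| "vren \<rho> (Res P) = Res (vren \<rho> P)"
| "vren \<rho> (Var X) = Var (\<rho> X)"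
| "vren \<rho> (Rec P) = Rec (vren (up \<rho>) P)"
| "vren \<rho> (Run P k Q) = Run (vren \<rho> P) k (vren \<rho> Q)"
| "vren \<rho> Co = Co"
| "vren \<rho> (Dorm P Q) = Dorm (vren \<rho> P) (vren \<rho> Q)"

text \<open>Simultaneous substitution for process variables, avoiding capture of variables and of names.\<close>

primrec psubst :: "(nat \<Rightarrow> ('n, 't) tm) \<Rightarrow> ('n, 't) tm \<Rightarrow> ('n, 't) tm" where
  "psubst s (Choice f) = Choice (\<lambda>i. map_option (map_prod id (psubst s)) (f i))"
| "psubst s (Par P Q) = Par (psubst s P) (psubst s Q)"
| "psubst s (Res P) = Res (psubst (\<lambda>X. nren Suc (s X)) P)"
| "psubst s (Var X) = s X"
| "psubst s (Rec P) = Rec (psubst (\<lambda>X. case X of 0 \<Rightarrow> Var 0 | Suc Y \<Rightarrow> vren Suc (s Y)) P)"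
| "psubst s (Run P k Q) = Run (psubst s P) k (psubst s Q)"
| "psubst s Co = Co"
| "psubst s (Dorm P Q) = Dorm (psubst s P) (psubst s Q)"

definition unfold_rec :: "('n, 't) tm \<Rightarrow> ('n, 't) tm" where
  "unfold_rec P = psubst (\<lambda>X. case X of 0 \<Rightarrow> Rec P | Suc Y \<Rightarrow> Var Y) P"

section \<open>Processes\<close>

inductive vfree :: "nat \<Rightarrow> ('n, 't) tm \<Rightarrow> bool" where
  "f i = Some (\<mu>, P) \<Longrightarrow> vfree X P \<Longrightarrow> vfree X (Choice f)"
| "vfree X P \<Longrightarrow> vfree X (Par P Q)"
| "vfree X Q \<Longrightarrow> vfree X (Par P Q)"
| "vfree X P \<Longrightarrow> vfree X (Res P)"
| "vfree X (Var X)"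
| "vfree (Suc X) P \<Longrightarrow> vfree X (Rec P)"
| "vfree X P \<Longrightarrow> vfree X (Run P k Q)"
| "vfree X Q \<Longrightarrow> vfree X (Run P k Q)"
| "vfree X P \<Longrightarrow> vfree X (Dorm P Q)"
| "vfree X Q \<Longrightarrow> vfree X (Dorm P Q)"

definition closed_tm :: "('n, 't) tm \<Rightarrow> bool" where
  "closed_tm P \<longleftrightarrow> (\<forall>X. \<not> vfree X P)"

text \<open>\<open>dangling n P\<close>: index \<open>n\<close> (counted at the root of \<open>P\<close>) is bound by no restriction of \<open>P\<close>.\<close>

inductive dangling :: "nat \<Rightarrow> ('n, 't) tm \<Rightarrow> bool" where
  "f i = Some (\<mu>, P) \<Longrightarrow> Bd n \<in> set_pre \<mu> \<Longrightarrow> dangling n (Choice f)"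
| "f i = Some (\<mu>, P) \<Longrightarrow> dangling n P \<Longrightarrow> dangling n (Choice f)"
| "dangling n P \<Longrightarrow> dangling n (Par P Q)"
| "dangling n Q \<Longrightarrow> dangling n (Par P Q)"
| "dangling (Suc n) P \<Longrightarrow> dangling n (Res P)"
| "dangling n P \<Longrightarrow> dangling n (Rec P)"
| "dangling n P \<Longrightarrow> dangling n (Run P k Q)"
| "dangling n Q \<Longrightarrow> dangling n (Run P k Q)"
| "dangling n P \<Longrightarrow> dangling n (Dorm P Q)"
| "dangling n Q \<Longrightarrow> dangling n (Dorm P Q)"

inductive subterm :: "('n, 't) tm \<Rightarrow> ('n, 't) tm \<Rightarrow> bool" where
  "subterm P P"
| "f i = Some (\<mu>, P) \<Longrightarrow> subterm S P \<Longrightarrow> subterm S (Choice f)"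
| "subterm S P \<Longrightarrow> subterm S (Par P Q)"
| "subterm S Q \<Longrightarrow> subterm S (Par P Q)"
| "subterm S P \<Longrightarrow> subterm S (Res P)"
| "subterm S P \<Longrightarrow> subterm S (Rec P)"
| "subterm S P \<Longrightarrow> subterm S (Run P k Q)"
| "subterm S Q \<Longrightarrow> subterm S (Run P k Q)"
| "subterm S P \<Longrightarrow> subterm S (Dorm P Q)"
| "subterm S Q \<Longrightarrow> subterm S (Dorm P Q)"

definition no_dorm :: "('n, 't) tm \<Rightarrow> bool" where
  "no_dorm P \<longleftrightarrow> \<not> (\<exists>P' Q'. subterm (Dorm P' Q') P)"

text \<open>The second conjunct only says that \<open>P\<close> denotes an ordinary term with named restrictions.\<close>

definition process :: "('n, 't) tm \<Rightarrow> bool" where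
  "process P \<longleftrightarrow>
     closed_tm P \<and>
     (\<forall>n. \<not> dangling n P) \<and>
     finite (ftn P) \<and>
     (\<forall>P1 k P1'. subterm (Run P1 k P1') P \<longrightarrow>
        ftn P1 = {} \<and> ftn P1' = {} \<and> no_dorm P1 \<and> closed_tm P1) \<and>
     (\<forall>P2 P2'. subterm (Dorm P2 P2') P \<longrightarrow>
        ftn P2 = {} \<and> ftn P2' = {} \<and> no_dorm P2 \<and> closed_tm P2) \<and>
     (\<forall>f i \<mu> Q. subterm (Choice f) P \<and> f i = Some (\<mu>, Q) \<longrightarrow> ftn Q = {} \<and> no_dorm Q) \<and>
     (\<forall>R. subterm (Rec R) P \<longrightarrow> ftn R = {})"

section \<open>Process transitions\<close>

text \<open>
  \<open>Eps\<close> is the empty substitution; \<open>To ks l\<close> maps the names \<open>ks\<close> to \<open>l\<close>.  The substitution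
  \<open>To [] l\<close> acts as the identity but, unlike \<open>Eps\<close>, has range \<open>{l}\<close>.
\<close>

datatype 't nsub = Eps | To "'t list" 't

primrec ndom :: "'t nsub \<Rightarrow> 't set" where
  "ndom Eps = {}"
| "ndom (To ks l) = set ks"

primrec nrange :: "'t nsub \<Rightarrow> 't set" where
  "nrange Eps = {}"
| "nrange (To ks l) = {l}"

primrec napply :: "'t nsub \<Rightarrow> 't \<Rightarrow> 't" where
  "napply Eps k = k"
| "napply (To ks l) k = (if k \<in> set ks then l else k)"

definition tsub :: "('n, 't) tm \<Rightarrow> 't nsub \<Rightarrow> ('n, 't) tm" where
  "tsub P \<sigma> = map_tm id (napply \<sigma>) P"

text \<open>Labels: \<open>Pl \<mu>\<close> is a plain action \<open>\<mu>\<close>, and \<open>At k \<mu>\<close> is \<open>k(\<mu>)\<close>.\<close>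

datatype ('c, 't) lab = Pl "'c pre" | At 't "'c pre"

text \<open>
  In rule \<open>res\<close> the label of the premise is \<open>\<alpha>\<close> with its indices shifted, i.e. any label in which
  neither the restricted name (index 0) nor its co-name occurs.
\<close>

inductive ptrans ::
  "('n, 't) tm \<Rightarrow> ('n chan, 't) lab \<Rightarrow> 't nsub \<Rightarrow> ('n, 't) tm \<Rightarrow> bool" where
  choice: "f i = Some (\<mu>, P) \<Longrightarrow> ptrans (Choice f) (Pl \<mu>) Eps P"
| com: "ptrans P (Pl (Vis a)) Eps P' \<Longrightarrow> ptrans Q (Pl (Vis (compl a))) Eps Q' \<Longrightarrow>
    ptrans (Par P Q) (Pl Tau) Eps (Par P' Q')"
| rec: "ptrans (Rec P) (Pl Tau) Eps (unfold_rec P)"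
| tchoice: "f i = Some (Vis a, P) \<Longrightarrow>
    ptrans (Choice f) (At k (Vis a)) (To [] k) (Run (Par P Co) k (Choice f))"
| trun: "ptrans P (Pl \<mu>) Eps P' \<Longrightarrow> k \<noteq> l \<Longrightarrow>
    ptrans (Run P l Q) (At k \<mu>) (To [l] k) (Run P' k Q)"
| tcom: "ptrans P (At k (Vis a)) (To ls1 k) P' \<Longrightarrow>
    ptrans Q (At k (Vis (compl a))) (To ls2 k) Q' \<Longrightarrow>
    ptrans (Par P Q) (At k Tau) (To (ls1 @ ls2) k)
      (Par (tsub P' (To ls2 k)) (tsub Q' (To ls1 k)))"
| parL: "ptrans P \<alpha> \<sigma> P' \<Longrightarrow> nrange \<sigma> \<inter> ftn Q = {} \<Longrightarrow>
    ptrans (Par P Q) \<alpha> \<sigma> (Par P' (tsub Q \<sigma>))"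
| parR: "ptrans Q \<alpha> \<sigma> Q' \<Longrightarrow> nrange \<sigma> \<inter> ftn P = {} \<Longrightarrow>
    ptrans (Par P Q) \<alpha> \<sigma> (Par (tsub P \<sigma>) Q')"
| res: "ptrans P (map_lab (ren_chan Suc) id \<alpha>) \<sigma> P' \<Longrightarrow> ptrans (Res P) \<alpha> \<sigma> (Res P')"

section \<open>Reconfiguration transitions\<close>

text \<open>
  Structural equivalence.  Alpha-conversion is built into the representation; in \<open>extr\<close> the
  shifted \<open>P\<close> is a term not containing the restricted name.  Rule \<open>ccong\<close> is congruence for sums,
  where a sum may also be re-indexed (so that it includes commutativity of sums).
\<close>

inductive seq :: "('n, 't) tm \<Rightarrow> ('n, 't) tm \<Rightarrow> bool"  (infix \<open>\<equiv>\<^sub>s\<close> 50) where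
  refl: "P \<equiv>\<^sub>s P"
| sym: "P \<equiv>\<^sub>s Q \<Longrightarrow> Q \<equiv>\<^sub>s P"
| trans: "P \<equiv>\<^sub>s Q \<Longrightarrow> Q \<equiv>\<^sub>s R \<Longrightarrow> P \<equiv>\<^sub>s R"
| unit: "Par P Nil0 \<equiv>\<^sub>s P"
| comm: "Par P Q \<equiv>\<^sub>s Par Q P"
| assoc: "Par (Par P Q) R \<equiv>\<^sub>s Par P (Par Q R)"
| resnil: "Res Nil0 \<equiv>\<^sub>s Nil0"
| resswap: "Res (Res P) \<equiv>\<^sub>s Res (Res (nren (id(0 := 1, 1 := 0)) P))"
| extr: "Res (Par (nren Suc P) Q) \<equiv>\<^sub>s Par P (Res Q)"
| ccong: "bij_betw \<pi> (dom f) (dom g) \<Longrightarrow>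
    (\<And>i \<mu> P. f i = Some (\<mu>, P) \<Longrightarrow> \<exists>P'. g (\<pi> i) = Some (\<mu>, P') \<and> P \<equiv>\<^sub>s P') \<Longrightarrow>
    Choice f \<equiv>\<^sub>s Choice g"
| pcong: "P \<equiv>\<^sub>s P' \<Longrightarrow> Q \<equiv>\<^sub>s Q' \<Longrightarrow> Par P Q \<equiv>\<^sub>s Par P' Q'"
| rescong: "P \<equiv>\<^sub>s P' \<Longrightarrow> Res P \<equiv>\<^sub>s Res P'"
| reccong: "P \<equiv>\<^sub>s P' \<Longrightarrow> Rec P \<equiv>\<^sub>s Rec P'"
| runcong: "P \<equiv>\<^sub>s P' \<Longrightarrow> Q \<equiv>\<^sub>s Q' \<Longrightarrow> Run P k Q \<equiv>\<^sub>s Run P' k Q'"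
| dormcong: "P \<equiv>\<^sub>s P' \<Longrightarrow> Q \<equiv>\<^sub>s Q' \<Longrightarrow> Dorm P Q \<equiv>\<^sub>s Dorm P' Q'"

text \<open>Removal of the \<open>Co\<close>s of a committing body; running transactions are deliberately excluded.\<close>

inductive strip_co :: "('n, 't) tm \<Rightarrow> ('n, 't) tm \<Rightarrow> bool" where
  "strip_co Co Nil0"
| "strip_co (Choice f) (Choice f)"
| "strip_co (Var X) (Var X)"
| "strip_co (Rec P) (Rec P)"
| "strip_co (Dorm P Q) (Dorm P Q)"
| "strip_co P P' \<Longrightarrow> strip_co (Res P) (Res P')"
| "strip_co P P' \<Longrightarrow> strip_co Q Q' \<Longrightarrow> strip_co (Par P Q) (Par P' Q')"

datatype 't rlab = CoL 't | AbL 't | NewL 't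

primrec rname :: "'t rlab \<Rightarrow> 't" where
  "rname (CoL k) = k"
| "rname (AbL k) = k"
| "rname (NewL k) = k"

inductive rtrans :: "('n, 't) tm \<Rightarrow> 't rlab \<Rightarrow> ('n, 't) tm \<Rightarrow> bool" where
  co: "P \<equiv>\<^sub>s Par Co P'' \<Longrightarrow> strip_co P P' \<Longrightarrow> rtrans (Run P k Q) (CoL k) P'"
| new: "rtrans (Dorm P Q) (NewL k) (Run P k Q)"
| ab: "rtrans (Run P k Q) (AbL k) Q"
| both: "\<beta> = CoL k \<or> \<beta> = AbL k \<Longrightarrow> rtrans P \<beta> P' \<Longrightarrow> rtrans Q \<beta> Q' \<Longrightarrow>
    rtrans (Par P Q) \<beta> (Par P' Q')"
| parL: "rtrans P \<beta> P' \<Longrightarrow> rname \<beta> \<notin> ftn Q \<Longrightarrow> rtrans (Par P Q) \<beta> (Par P' Q)"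
| parR: "rtrans Q \<beta> Q' \<Longrightarrow> rname \<beta> \<notin> ftn P \<Longrightarrow> rtrans (Par P Q) \<beta> (Par P Q')"
| res: "rtrans P \<beta> P' \<Longrightarrow> rtrans (Res P) \<beta> (Res P')"

section \<open>Extended configurations\<close>

text \<open>
  The index set of histories is \<open>nat\<close>.  A history entry \<open>(k, StAct a)\<close>, \<open>(k, StAb)\<close>, \<open>(k, StCo)\<close>
  stands for \<open>k(a)\<close>, \<open>k(ab)\<close>, \<open>k(co)\<close> respectively.
\<close>

datatype 'n status = StAct "'n act" | StAb | StCo

type_synonym ('n, 'e) hist = "nat \<rightharpoonup> 'e \<times> 'n status"

type_synonym ('n, 'i, 'e) proc = "('n, ('i, 'e) trn) tm"

type_synonym ('n, 'i, 'e) conf =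
  "('i, 'e) trn rel \<times> ('n, 'e) hist \<times> ('n, 'i, 'e) proc"

definition Htrn :: "('n, 'e) hist \<Rightarrow> 'e set" where
  "Htrn H = {k. \<exists>i s. H i = Some (k, s)}"

definition Hasco :: "('n, 'e) hist \<Rightarrow> 'e set" where
  "Hasco H = {k. \<exists>i. H i = Some (k, StCo)}"

text \<open>The last conjunct is the convention that external names of a process are in its history.\<close>

fun config :: "('n, 'i, 'e) conf \<Rightarrow> bool" where
  "config (E, H, P) \<longleftrightarrow>
     process P \<and>
     finite (Field E) \<and> equiv (Field E) E \<and>
     finite (dom H) \<and>
     (\<forall>i j k s t. H i = Some (k, s) \<and> H j = Some (k, t) \<longrightarrow> i = j) \<and>
     (\<forall>k. (ExT k, ExT k) \<in> E \<longleftrightarrow> k \<in> Htrn H) \<and>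
     (\<forall>k k'. (ExT k, ExT k') \<in> E \<longrightarrow> (k \<in> Hasco H \<longleftrightarrow> k' \<in> Hasco H)) \<and>
     ftn P \<inter> ExT ` Hasco H = {} \<and>
     (\<forall>k k'. (k, k') \<in> E \<and> k \<in> ftn P \<and> k' \<in> ftn P \<longrightarrow> k = k') \<and>
     (\<forall>k. ExT k \<in> ftn P \<longrightarrow> k \<in> Htrn H)"

definition trn_env :: "('i, 'e) trn rel \<Rightarrow> ('n, 'e) hist \<Rightarrow> ('i, 'e) trn set" where
  "trn_env E H = Field E \<union> ExT ` Htrn H"

definition esub :: "'t nsub \<Rightarrow> 't rel \<Rightarrow> 't rel" where
  "esub \<sigma> E = \<Inter> {F. equiv (Field F) F \<and> E \<subseteq> F \<and>
     (\<forall>l \<in> nrange \<sigma>. (l, l) \<in> F \<and> (\<forall>k \<in> ndom \<sigma>. (k, l) \<in> F))}"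

text \<open>\<open>settle s E H k\<close> is the history of \<open>(E; H)\<close> after committing (\<open>s = StCo\<close>) or aborting
  (\<open>s = StAb\<close>) the transaction \<open>k\<close>.\<close>

definition settle ::
  "'n status \<Rightarrow> ('i, 'e) trn rel \<Rightarrow> ('n, 'e) hist \<Rightarrow> ('i, 'e) trn \<Rightarrow> ('n, 'e) hist" where
  "settle s E H k = (\<lambda>i. case H i of
      Some (k', StAct a) \<Rightarrow> if (ExT k', k) \<in> E then Some (k', s) else H i
    | _ \<Rightarrow> H i)"

definition Eext :: "('i, 'e) trn rel \<Rightarrow> ('i, 'e) trn \<Rightarrow> 'e set" where
  "Eext E k = {k'. (k, ExT k') \<in> E}"

section \<open>Extended and commit-sensitive transitions\<close>

text \<open>The two transition systems differ only in the commit rules.\<close>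

datatype sys = SysE | SysC

datatype ('n, 'e) xlab = XTau | XAct 'e "'n act" | XCo "'e set"

inductive xrule ::
  "sys \<Rightarrow> ('n, 'i, 'e) conf \<Rightarrow> ('n, 'e) xlab \<Rightarrow> ('n, 'i, 'e) conf \<Rightarrow> bool" for s where
  tau: "ptrans P (Pl Tau) Eps Q \<Longrightarrow> xrule s (E, H, P) XTau (E, H, Q)"
| ttau: "ptrans P (At (InT k) Tau) \<sigma> Q \<Longrightarrow> InT k \<notin> trn_env E H \<Longrightarrow>
    xrule s (E, H, P) XTau (esub \<sigma> E, H, Q)"
| new: "rtrans P (NewL (InT k)) Q \<Longrightarrow> InT k \<notin> trn_env E H \<Longrightarrow>
    xrule s (E, H, P) XTau (E, H, Q)"
| coE: "s = SysE \<Longrightarrow> rtrans P (CoL k) Q \<Longrightarrow>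
    xrule s (E, H, P) XTau (E, settle StCo E H k, Q)"
| coC: "s = SysC \<Longrightarrow> rtrans P (CoL k) Q \<Longrightarrow> Eext E k \<noteq> {} \<Longrightarrow>
    xrule s (E, H, P) (XCo (Eext E k)) (E, settle StCo E H k, Q)"
| coCtau: "s = SysC \<Longrightarrow> rtrans P (CoL k) Q \<Longrightarrow> Eext E k = {} \<Longrightarrow>
    xrule s (E, H, P) XTau (E, settle StCo E H k, Q)"
| ab: "rtrans P (AbL k) Q \<Longrightarrow> xrule s (E, H, P) XTau (E, settle StAb E H k, Q)"
| act: "ptrans P (At (ExT k) (Vis (map_act Fr a))) \<sigma> Q \<Longrightarrow> ExT k \<notin> trn_env E H \<Longrightarrow>
    i \<notin> dom H \<Longrightarrow>
    xrule s (E, H, P) (XAct k a) (esub \<sigma> E, H(i \<mapsto> (k, StAct a)), Q)"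
| env: "ExT k \<notin> trn_env E H \<Longrightarrow> ExT k \<notin> ftn P \<Longrightarrow> i \<notin> dom H \<Longrightarrow>
    xrule s (E, H, P) (XAct k a) (insert (ExT k, ExT k) E, H(i \<mapsto> (k, StAb)), P)"

text \<open>Transitions relate extended configurations only.\<close>

definition xtrans ::
  "sys \<Rightarrow> ('n, 'e) xlab \<Rightarrow> ('n, 'i, 'e) conf \<Rightarrow> ('n, 'i, 'e) conf \<Rightarrow> bool" where
  "xtrans s \<zeta> C C' \<longleftrightarrow> config C \<and> config C' \<and> xrule s C \<zeta> C'"

definition weak ::
  "sys \<Rightarrow> ('n, 'e) xlab \<Rightarrow> ('n, 'i, 'e) conf \<Rightarrow> ('n, 'i, 'e) conf \<Rightarrow> bool" where
  "weak s \<zeta> = (if \<zeta> = XTau then (xtrans s XTau)\<^sup>*\<^sup>*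
     else (xtrans s XTau)\<^sup>*\<^sup>* OO xtrans s \<zeta> OO (xtrans s XTau)\<^sup>*\<^sup>*)"

section \<open>Bisimulations\<close>

text \<open>Freshness of a label for a configuration; only used for labels \<open>\<tau>\<close> and \<open>k(a)\<close>.\<close>

fun xfresh :: "('n, 'e) xlab \<Rightarrow> ('n, 'i, 'e) conf \<Rightarrow> bool" where
  "xfresh XTau (E, H, P) \<longleftrightarrow> True"
| "xfresh (XAct k a) (E, H, P) \<longleftrightarrow> ExT k \<notin> trn_env E H \<union> ftn P"
| "xfresh (XCo K) (E, H, P) \<longleftrightarrow> ExT ` K \<inter> (trn_env E H \<union> ftn P) = {}"

type_synonym ('n, 'i, 'e) crel = "('n, 'i, 'e) conf \<Rightarrow> ('n, 'i, 'e) conf \<Rightarrow> bool"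

definition on_configs :: "('n, 'i, 'e) crel \<Rightarrow> bool" where
  "on_configs R \<longleftrightarrow> (\<forall>C1 C2. R C1 C2 \<longrightarrow> config C1 \<and> config C2)"

definition half_transfer :: "sys \<Rightarrow> ('n, 'i, 'e) crel \<Rightarrow> bool" where
  "half_transfer s R \<longleftrightarrow> (\<forall>C1 C2 \<zeta> C1'. R C1 C2 \<and> (\<zeta> = XTau \<or> (\<exists>k a. \<zeta> = XAct k a)) \<and>
     weak s \<zeta> C1 C1' \<and> xfresh \<zeta> C2 \<longrightarrow> (\<exists>C2'. weak s \<zeta> C2 C2' \<and> R C1' C2'))"

definition transfer :: "sys \<Rightarrow> ('n, 'i, 'e) crel \<Rightarrow> bool" where
  "transfer s R \<longleftrightarrow> half_transfer s R \<and> half_transfer s R\<inverse>\<inverse>"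

fun conf_hasco :: "('n, 'i, 'e) conf \<Rightarrow> 'e set" where
  "conf_hasco (E, H, P) = Hasco H"

definition hasco_bisim :: "('n, 'i, 'e) crel \<Rightarrow> bool" where
  "hasco_bisim R \<longleftrightarrow> on_configs R \<and> transfer SysE R \<and>
     (\<forall>C1 C2. R C1 C2 \<longrightarrow> conf_hasco C1 = conf_hasco C2)"

fun sat_eqco :: "('n, 'i, 'e) conf \<Rightarrow> 'e \<Rightarrow> 'e \<Rightarrow> bool" where
  "sat_eqco (E, H, P) k k' \<longleftrightarrow> k \<in> Hasco H \<and> k' \<in> Hasco H \<and> (ExT k, ExT k') \<in> E"

definition eq_bisim :: "('n, 'i, 'e) crel \<Rightarrow> bool" where
  "eq_bisim R \<longleftrightarrow> on_configs R \<and> transfer SysE R \<and>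
     (\<forall>C1 C2. R C1 C2 \<longrightarrow> (\<forall>k k'. sat_eqco C1 k k' \<longleftrightarrow> sat_eqco C2 k k'))"

definition half_commit_transfer :: "('n, 'i, 'e) crel \<Rightarrow> bool" where
  "half_commit_transfer R \<longleftrightarrow> (\<forall>C1 C2 K C1'. R C1 C2 \<and> weak SysC (XCo K) C1 C1' \<longrightarrow>
     (\<exists>C2'. weak SysC (XCo K) C2 C2' \<and> R C1' C2'))"

definition canco_bisim :: "('n, 'i, 'e) crel \<Rightarrow> bool" where
  "canco_bisim R \<longleftrightarrow> on_configs R \<and> transfer SysC R \<and>
     half_commit_transfer R \<and> half_commit_transfer R\<inverse>\<inverse>"

definition largest :: "(('n, 'i, 'e) crel \<Rightarrow> bool) \<Rightarrow> ('n, 'i, 'e) crel" where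
  "largest bis C1 C2 \<longleftrightarrow> (\<exists>R. bis R \<and> R C1 C2)"

text \<open>The union of all bisimulations of each kind is indeed the largest one.\<close>

lemma largest_union: "bis R \<Longrightarrow> R C1 C2 \<Longrightarrow> largest bis C1 C2"
  unfolding largest_def by blast

lemma on_configs_largest:
  assumes "\<And>R. bis R \<Longrightarrow> on_configs R"
  shows "on_configs (largest bis)"
  unfolding on_configs_def
proof (intro allI impI)
  fix C1 C2
  assume "largest bis C1 C2"
  then obtain R where "bis R" "R C1 C2" unfolding largest_def by blast
  then show "config C1 \<and> config C2" using assms[of R] unfolding on_configs_def by blast
qed

lemma half_transfer_largest:
  fixes bis :: "('n, 'i, 'e) crel \<Rightarrow> bool"
  assumes "\<And>R. bis R \<Longrightarrow> transfer s R"
  shows "half_transfer s (largest bis)"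
  unfolding half_transfer_def
proof (intro allI impI; elim conjE)
  fix C1 C2 C1' :: "('n, 'i, 'e) conf" and \<zeta> :: "('n, 'e) xlab"
  assume \<zeta>: "\<zeta> = XTau \<or> (\<exists>k a. \<zeta> = XAct k a)" and w: "weak s \<zeta> C1 C1'" "xfresh \<zeta> C2"
    and "largest bis C1 C2"
  then obtain R where R: "bis R" "R C1 C2" unfolding largest_def by auto
  have "half_transfer s R" using assms[OF R(1)] by (simp add: transfer_def)
  then obtain C2' where "weak s \<zeta> C2 C2'" "R C1' C2'"
    using R(2) \<zeta> w unfolding half_transfer_def by blast
  then show "\<exists>C2'. weak s \<zeta> C2 C2' \<and> largest bis C1' C2'"
    using largest_union[of bis, OF R(1)] unfolding conversep_iff by blast
qed

lemma half_transfer_conv_largest: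
  fixes bis :: "('n, 'i, 'e) crel \<Rightarrow> bool"
  assumes "\<And>R. bis R \<Longrightarrow> transfer s R"
  shows "half_transfer s (largest bis)\<inverse>\<inverse>"
  unfolding half_transfer_def
proof (intro allI impI; elim conjE)
  fix C1 C2 C1' :: "('n, 'i, 'e) conf" and \<zeta> :: "('n, 'e) xlab"
  assume \<zeta>: "\<zeta> = XTau \<or> (\<exists>k a. \<zeta> = XAct k a)" and w: "weak s \<zeta> C1 C1'" "xfresh \<zeta> C2"
    and "(largest bis)\<inverse>\<inverse> C1 C2"
  then obtain R where R: "bis R" "R\<inverse>\<inverse> C1 C2" unfolding largest_def by auto
  have "half_transfer s R\<inverse>\<inverse>" using assms[OF R(1)] by (simp add: transfer_def)
  then obtain C2' where "weak s \<zeta> C2 C2'" "R\<inverse>\<inverse> C1' C2'"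
    using R(2) \<zeta> w unfolding half_transfer_def by blast
  then show "\<exists>C2'. weak s \<zeta> C2 C2' \<and> (largest bis)\<inverse>\<inverse> C1' C2'"
    using largest_union[of bis, OF R(1)] unfolding conversep_iff by blast
qed

lemma transfer_largest:
  assumes "\<And>R. bis R \<Longrightarrow> transfer s R"
  shows "transfer s (largest bis)"
  using half_transfer_largest[OF assms] half_transfer_conv_largest[OF assms]
  unfolding transfer_def by blast

lemma hasco_bisim_largest: "hasco_bisim (largest hasco_bisim)"
proof -
  have "transfer SysE (largest hasco_bisim)"
    by (rule transfer_largest) (simp add: hasco_bisim_def)
  moreover have "on_configs (largest hasco_bisim)"
    by (rule on_configs_largest) (simp add: hasco_bisim_def)
  moreover have "conf_hasco C1 = conf_hasco C2" if largest: "largest hasco_bisim C1 C2" for C1 C2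
  proof -
    obtain R where R: "hasco_bisim R" "R C1 C2" using largest unfolding largest_def by blast
    show ?thesis using R(1)[unfolded hasco_bisim_def] R(2) by blast
  qed
  ultimately show ?thesis unfolding hasco_bisim_def[of "largest hasco_bisim"] by blast
qed

lemma eq_bisim_largest: "eq_bisim (largest eq_bisim)"
proof -
  have "transfer SysE (largest eq_bisim)"
    by (rule transfer_largest) (simp add: eq_bisim_def)
  moreover have "on_configs (largest eq_bisim)"
    by (rule on_configs_largest) (simp add: eq_bisim_def)
  moreover have "\<forall>k k'. sat_eqco C1 k k' \<longleftrightarrow> sat_eqco C2 k k'" if largest: "largest eq_bisim C1 C2" for C1 C2
  proof -
    obtain R where R: "eq_bisim R" "R C1 C2" using largest unfolding largest_def by blast
    show ?thesis using R(1)[unfolded eq_bisim_def] R(2) by blast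
  qed
  ultimately show ?thesis unfolding eq_bisim_def[of "largest eq_bisim"] by blast
qed

lemma canco_bisim_largest: "canco_bisim (largest canco_bisim)"
proof -
  have "transfer SysC (largest canco_bisim)"
    by (rule transfer_largest) (simp add: canco_bisim_def)
  moreover have "half_commit_transfer (largest canco_bisim)"
    unfolding half_commit_transfer_def
  proof (intro allI impI; elim conjE)
    fix C1 C2 K C1'
    assume "largest canco_bisim C1 C2" and w: "weak SysC (XCo K) C1 C1'"
    then obtain R where R: "canco_bisim R" "R C1 C2" unfolding largest_def by blast
    have "half_commit_transfer R" using R(1) by (simp add: canco_bisim_def)
    then obtain C2' where "weak SysC (XCo K) C2 C2'" "R C1' C2'"
      using R(2) w unfolding half_commit_transfer_def by blast
    then show "\<exists>C2'. weak SysC (XCo K) C2 C2' \<and> largest canco_bisim C1' C2'"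
      using largest_union[of canco_bisim, OF R(1)] by blast
  qed
  moreover have "half_commit_transfer (largest canco_bisim)\<inverse>\<inverse>"
    unfolding half_commit_transfer_def conversep_iff
  proof (intro allI impI; elim conjE)
    fix C1 C2 K C1'
    assume "largest canco_bisim C2 C1" and w: "weak SysC (XCo K) C1 C1'"
    then obtain R where R: "canco_bisim R" "R C2 C1" unfolding largest_def by blast
    have "half_commit_transfer R\<inverse>\<inverse>" using R(1) by (simp add: canco_bisim_def)
    then obtain C2' where "weak SysC (XCo K) C2 C2'" "R C2' C1'"
      using R(2) w unfolding half_commit_transfer_def conversep_iff by blast
    then show "\<exists>C2'. weak SysC (XCo K) C2 C2' \<and> largest canco_bisim C2' C1'"
      using largest_union[of canco_bisim, OF R(1)] by blast
  qed
  moreover have "on_configs (largest canco_bisim)"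
    by (rule on_configs_largest) (simp add: canco_bisim_def)
  ultimately show ?thesis unfolding canco_bisim_def[of "largest canco_bisim"] by blast
qed

text \<open>The equivalences on processes, by viewing a process as a configuration with empty relation
  and history.\<close>

definition on_procs :: "('n, 'i, 'e) crel \<Rightarrow> ('n, 'i, 'e) proc \<Rightarrow> ('n, 'i, 'e) proc \<Rightarrow> bool" where
  "on_procs R P Q \<longleftrightarrow> R ({}, Map.empty, P) ({}, Map.empty, Q)"

definition approx_Hasco :: "('n, 'i, 'e) proc \<Rightarrow> ('n, 'i, 'e) proc \<Rightarrow> bool"
    (infix \<open>\<approx>\<^bsub>Hasco\<^esub>\<close> 50) where
  "approx_Hasco = on_procs (largest hasco_bisim)"

definition approx_Eq :: "('n, 'i, 'e) proc \<Rightarrow> ('n, 'i, 'e) proc \<Rightarrow> bool"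
    (infix \<open>\<approx>\<^bsub>Eq\<^esub>\<close> 50) where
  "approx_Eq = on_procs (largest eq_bisim)"

definition approx_Canco :: "('n, 'i, 'e) proc \<Rightarrow> ('n, 'i, 'e) proc \<Rightarrow> bool"
    (infix \<open>\<approx>\<^bsub>Canco\<^esub>\<close> 50) where
  "approx_Canco = on_procs (largest canco_bisim)"

end

theory Submission
  imports Defs
begin

text \<open>
  In every configuration reachable from a process, the external names related to a name that still
  occurs in the process are all active.  Hence a commit settles a whole class of external names at
  once, and the class of a committed name is frozen from then on.  A commit labelled \<open>co(K)\<close> is
  therefore the same thing as an internal step whose newly committed names are \<open>K\<close>, which relates
  the commit-sensitive system to \<open>Hasco\<close>.  For \<open>Eq\<close>, suppose that \<open>k\<close> and \<open>k'\<close> commit together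
  on one side; if they committed separately on the other side, there would be an intermediate
  configuration with just one of them committed, which the first side, where \<open>k\<close> and \<open>k'\<close> are
  already merged, cannot match.
\<close>

section \<open>Transaction names under process transitions\<close>

lemma ftn_Choice: "ftn (Choice f) = {t. \<exists>i \<mu> P. f i = Some (\<mu>, P) \<and> t \<in> ftn P}"
proof (intro set_eqI iffI)
  fix t assume "t \<in> ftn (Choice f)"
  then show "t \<in> {t. \<exists>i \<mu> P. f i = Some (\<mu>, P) \<and> t \<in> ftn P}"
    by (auto simp: prod_set_simps elim!: snds.cases) metis
next
  fix t assume "t \<in> {t. \<exists>i \<mu> P. f i = Some (\<mu>, P) \<and> t \<in> ftn P}"
  then obtain i \<mu> P where "f i = Some (\<mu>, P)" "t \<in> ftn P" by blast
  then show "t \<in> ftn (Choice f)"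
    by (auto intro!: exI[of _ i] simp: prod_set_simps)
qed

text \<open>The generated rule reaches the summands of a \<open>Choice\<close> only through nested
  option and pair set functions; here the hypothesis is available directly at each summand.\<close>

lemma tm_induct [case_names Choice Par Res Var Rec Run Co Dorm]:
  assumes "\<And>f. (\<And>i \<mu> P. f i = Some (\<mu>, P) \<Longrightarrow> R P) \<Longrightarrow> R (Choice f)"
    and "\<And>P Q. R P \<Longrightarrow> R Q \<Longrightarrow> R (Par P Q)"
    and "\<And>P. R P \<Longrightarrow> R (Res P)"
    and "\<And>X. R (Var X)"
    and "\<And>P. R P \<Longrightarrow> R (Rec P)"
    and "\<And>P k Q. R P \<Longrightarrow> R Q \<Longrightarrow> R (Run P k Q)"
    and "R Co"
    and "\<And>P Q. R P \<Longrightarrow> R Q \<Longrightarrow> R (Dorm P Q)"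
  shows "R P"
proof (induction P)
  case (Choice f)
  have "R P" if "f i = Some (\<mu>, P)" for i \<mu> P
    using Choice[of "Some (\<mu>, P)" "(\<mu>, P)" P] that by (metis option.set_intros prod_set_simps(2) rangeI singletonI)
  then show ?case by (rule assms(1))
qed (use assms in auto)

section \<open>Names after renaming and substitution\<close>

lemma ftn_nren_subset: "ftn (nren \<rho> P) \<subseteq> ftn P"
proof (induction P arbitrary: \<rho> rule: tm_induct)
  case (Choice f)
  then show ?case by (fastforce simp: ftn_Choice simp del: tm.set)
qed fastforce+

lemma ftn_vren_subset: "ftn (vren \<rho> P) \<subseteq> ftn P"
proof (induction P arbitrary: \<rho> rule: tm_induct)
  case (Choice f)
  then show ?case by (fastforce simp: ftn_Choice simp del: tm.set)
qed fastforce+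

lemma ftn_psubst_subset: "ftn (psubst s P) \<subseteq> ftn P \<union> (\<Union>X. ftn (s X))"
proof (induction P arbitrary: s rule: tm_induct)
  case (Choice f)
  then show ?case by (fastforce simp: ftn_Choice simp del: tm.set)
next
  case (Res P)
  have "(\<Union>X. ftn (nren Suc (s X))) \<subseteq> (\<Union>X. ftn (s X))"
    using ftn_nren_subset by fastforce
  with Res[of "\<lambda>X. nren Suc (s X)"] show ?case by auto
next
  case (Rec P)
  let ?s = "\<lambda>X. case X of 0 \<Rightarrow> Var 0 | Suc Y \<Rightarrow> vren Suc (s Y)"
  have "ftn (?s X) \<subseteq> (\<Union>X. ftn (s X))" for X
    using ftn_vren_subset by (fastforce split: nat.splits)
  with Rec[of ?s] show ?case by fastforce
qed fastforce+

lemma ftn_unfold_rec_subset: "ftn (unfold_rec P) \<subseteq> ftn P"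
proof -
  let ?s = "\<lambda>X. case X of 0 \<Rightarrow> Rec P | Suc Y \<Rightarrow> Var Y"
  have "ftn (?s X) \<subseteq> ftn P" for X by (simp split: nat.splits)
  then show ?thesis using ftn_psubst_subset[of ?s P] unfolding unfold_rec_def by blast
qed

lemma ftn_tsub_subset: "ftn (tsub P \<sigma>) \<subseteq> ftn P \<union> nrange \<sigma>"
  by (cases \<sigma>) (auto simp: tsub_def tm.set_map)

text \<open>Labels of the form \<open>At\<close> originate only in \<open>tchoice\<close>,
  \<open>trun\<close> and \<open>tcom\<close>, whose substitutions all have range
  \<open>{k}\<close>; the contextual rules pass label and substitution on unchanged.\<close>

lemma ptrans_range: "ptrans P \<alpha> \<sigma> P' \<Longrightarrow> \<alpha> = At k \<mu> \<Longrightarrow> \<exists>ls. \<sigma> = To ls k"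
  by (induction arbitrary: \<mu> rule: ptrans.induct) auto

text \<open>The first half makes the invariant on occurring names applicable to every name that is
  merged; the second half leaves only the range of the substitution as a possible new name.\<close>

lemma ptrans_ftn: "ptrans P \<alpha> \<sigma> P' \<Longrightarrow> ndom \<sigma> \<subseteq> ftn P \<and> ftn P' \<subseteq> ftn P \<union> nrange \<sigma>"
proof (induction rule: ptrans.induct)
  case (choice f i \<mu> P)
  then show ?case unfolding ftn_Choice by auto
next
  case (rec P)
  then show ?case using ftn_unfold_rec_subset[of P] by auto
next
  case (tchoice f i a P k)
  then show ?case by (auto simp: ftn_Choice simp del: tm.set(1))
next
  case (tcom P k a ls1 P' Q ls2 Q')
  then show ?case using ftn_tsub_subset[of P' "To ls2 k"] ftn_tsub_subset[of Q' "To ls1 k"] by auto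
next
  case (parL P \<alpha> \<sigma> P' Q)
  then show ?case using ftn_tsub_subset[of Q \<sigma>] by auto
next
  case (parR Q \<alpha> \<sigma> Q' P)
  then show ?case using ftn_tsub_subset[of P \<sigma>] by auto
qed auto

section \<open>Transaction names under reconfiguration transitions\<close>

text \<open>The fragment of \<open>process\<close> used in inductions on \<open>rtrans\<close>.
  Unlike \<open>process\<close>, it passes to the body of a restriction, where index 0 may
  dangle.\<close>

definition nameless_runs :: "('n, 't) tm \<Rightarrow> bool" where
  "nameless_runs P \<longleftrightarrow> (\<forall>P1 k P2. subterm (Run P1 k P2) P \<longrightarrow> ftn P1 = {} \<and> ftn P2 = {})"

lemma nameless_runs_Par: "nameless_runs (Par P Q) \<Longrightarrow> nameless_runs P \<and> nameless_runs Q"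
  unfolding nameless_runs_def by (meson subterm.intros)

lemma nameless_runs_Res: "nameless_runs (Res P) \<Longrightarrow> nameless_runs P"
  unfolding nameless_runs_def by (meson subterm.intros)

lemma nameless_runs_Run: "nameless_runs (Run P k Q) \<Longrightarrow> ftn P = {} \<and> ftn Q = {}"
  unfolding nameless_runs_def by (meson subterm.intros)

lemma process_nameless_runs: "process P \<Longrightarrow> nameless_runs P"
  unfolding process_def nameless_runs_def by blast

lemma strip_co_ftn: "strip_co P P' \<Longrightarrow> ftn P' \<subseteq> ftn P"
  by (induction rule: strip_co.induct) auto

lemma rtrans_new_ftn: "rtrans P \<beta> P' \<Longrightarrow> \<beta> = NewL k \<Longrightarrow> ftn P' \<subseteq> insert k (ftn P)"
  by (induction rule: rtrans.induct) auto

text \<open>The settled transaction leaves behind a term without transaction names, and a parallel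
  component either settles \<open>k\<close> as well or does not contain it. Hence \<open>k\<close>
  disappears altogether.\<close>

lemma rtrans_settle_ftn:
  "rtrans P \<beta> P' \<Longrightarrow> \<beta> = CoL k \<or> \<beta> = AbL k \<Longrightarrow> nameless_runs P \<Longrightarrow>
     k \<in> ftn P \<and> ftn P' \<subseteq> ftn P - {k}"
proof (induction rule: rtrans.induct)
  case (co P P'' P' l Q)
  then show ?case using strip_co_ftn[of P P'] nameless_runs_Run[of P l Q] by auto
next
  case (ab P l Q)
  then show ?case using nameless_runs_Run[of P l Q] by auto
qed (auto dest!: nameless_runs_Par nameless_runs_Res)

section \<open>Live configurations\<close>

lemma configD:
  assumes "config (E, H, P)"
  shows config_process: "process P"
    and config_equiv: "equiv (Field E) E"
    and config_index: "H i = Some (k, s) \<Longrightarrow> H j = Some (k, t) \<Longrightarrow> i = j"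
    and config_Htrn_iff: "(ExT k, ExT k) \<in> E \<longleftrightarrow> k \<in> Htrn H"
    and config_Hasco_iff: "(ExT k, ExT k') \<in> E \<Longrightarrow> k \<in> Hasco H \<longleftrightarrow> k' \<in> Hasco H"
    and config_ftn_Hasco: "ExT k \<in> ftn P \<Longrightarrow> k \<notin> Hasco H"
    and config_ftn_eq: "(x, y) \<in> E \<Longrightarrow> x \<in> ftn P \<Longrightarrow> y \<in> ftn P \<Longrightarrow> x = y"
    and config_ftn_Htrn: "ExT k \<in> ftn P \<Longrightarrow> k \<in> Htrn H"
proof -
  from assms
  have P: "process P" and E: "equiv (Field E) E"
    and H: "\<forall>i j k s t. H i = Some (k, s) \<and> H j = Some (k, t) \<longrightarrow> i = j"
    and *: "\<forall>k. (ExT k, ExT k) \<in> E \<longleftrightarrow> k \<in> Htrn H"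
      "\<forall>k k'. (ExT k, ExT k') \<in> E \<longrightarrow> (k \<in> Hasco H \<longleftrightarrow> k' \<in> Hasco H)"
      "ftn P \<inter> ExT ` Hasco H = {}"
      "\<forall>k k'. (k, k') \<in> E \<and> k \<in> ftn P \<and> k' \<in> ftn P \<longrightarrow> k = k'"
      "\<forall>k. ExT k \<in> ftn P \<longrightarrow> k \<in> Htrn H"
    unfolding config.simps by - (elim conjE, assumption)+
  show "process P" by (fact P)
  show "equiv (Field E) E" by (fact E)
  show "H i = Some (k, s) \<Longrightarrow> H j = Some (k, t) \<Longrightarrow> i = j" using H by blast
  show "(ExT k, ExT k) \<in> E \<longleftrightarrow> k \<in> Htrn H" using *(1) by simp
  show "(ExT k, ExT k') \<in> E \<Longrightarrow> k \<in> Hasco H \<longleftrightarrow> k' \<in> Hasco H" using *(2) by simp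
  show "ExT k \<in> ftn P \<Longrightarrow> k \<notin> Hasco H" using *(3) by blast
  show "(x, y) \<in> E \<Longrightarrow> x \<in> ftn P \<Longrightarrow> y \<in> ftn P \<Longrightarrow> x = y" using *(4) by blast
  show "ExT k \<in> ftn P \<Longrightarrow> k \<in> Htrn H" using *(5) by simp
qed

declare config.simps [simp del]

lemma config_sym: "config (E, H, P) \<Longrightarrow> (x, y) \<in> E \<Longrightarrow> (y, x) \<in> E"
  by (drule config_equiv) (auto simp: equiv_def dest: symD)

lemma config_trans: "config (E, H, P) \<Longrightarrow> (x, y) \<in> E \<Longrightarrow> (y, z) \<in> E \<Longrightarrow> (x, z) \<in> E"
  by (drule config_equiv) (auto simp: equiv_def dest: transD)

lemma config_active_not_Hasco:
  "config (E, H, P) \<Longrightarrow> H i = Some (k, StAct a) \<Longrightarrow> k \<notin> Hasco H"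
  using config_index[of E H P i k "StAct a" _ StCo] by (auto simp: Hasco_def)

text \<open>The invariant behind all later results. \<open>config\<close> alone lets an occurring
  name be related to an aborted external name, and an occurring internal name to a committed one, so
  that a commit of its class could settle only a part of it.\<close>

definition live :: "('n, 'i, 'e) conf \<Rightarrow> bool" where
  "live C \<longleftrightarrow> config C \<and> (case C of (E, H, P) \<Rightarrow>
     \<forall>l \<in> ftn P. \<forall>k. (l, ExT k) \<in> E \<longrightarrow> (\<exists>i a. H i = Some (k, StAct a)))"

lemma live_config: "live C \<Longrightarrow> config C"
  by (simp add: live_def)

lemma live_active:
  "live (E, H, P) \<Longrightarrow> l \<in> ftn P \<Longrightarrow> (l, ExT k) \<in> E \<Longrightarrow> \<exists>i a. H i = Some (k, StAct a)"
  by (simp add: live_def)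

lemma liveI:
  "config (E, H, P) \<Longrightarrow>
     (\<And>l k. l \<in> ftn P \<Longrightarrow> (l, ExT k) \<in> E \<Longrightarrow> \<exists>i a. H i = Some (k, StAct a)) \<Longrightarrow>
     live (E, H, P)"
  by (simp add: live_def)

section \<open>Merging classes of transaction names\<close>

lemma esub_mono: "(x, y) \<in> E \<Longrightarrow> (x, y) \<in> esub \<sigma> E"
  by (auto simp: esub_def)

text \<open>\<open>esub\<close> is an intersection, so it lies below any equivalence that contains
  \<open>E\<close> and the new pairs. One such equivalence collapses to a single class the set
  \<open>A\<close>, made of \<open>k\<close>, the merged names and their old classes.\<close>

lemma esub_cases:
  assumes E: "equiv (Field E) E" and k: "k \<notin> Field E" and xy: "(x, y) \<in> esub (To ls k) E"
  defines "A \<equiv> insert k (set ls \<union> E `` set ls)"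
  shows "(x, y) \<in> E \<or> x \<in> A \<and> y \<in> A"
proof -
  define F where "F = E \<union> A \<times> A"
  \<comment> \<open>\<open>A\<close> is saturated under \<open>E\<close>: the fresh \<open>k\<close>
    has no \<open>E\<close>-neighbours, and the rest is closed by transitivity.\<close>
  have closed: "v \<in> A" if "u \<in> A" "(u, v) \<in> E" for u v
    using that E k unfolding A_def equiv_def by (auto dest: transD intro: FieldI1)
  have symE: "(v, u) \<in> E" if "(u, v) \<in> E" for u v
    using that E by (auto simp: equiv_def dest: symD)
  have transE: "(u, w) \<in> E" if "(u, v) \<in> E" "(v, w) \<in> E" for u v w
    using that E by (auto simp: equiv_def dest: transD)
  have refl: "(u, u) \<in> E" if "u \<in> Field E" for u
    using that E by (auto simp: equiv_def refl_on_def)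
  have "equiv (Field F) F"
  proof (rule equivI)
    show "F \<subseteq> Field F \<times> Field F" by (auto simp: Field_def)
    show "refl_on (Field F) F"
      using refl unfolding refl_on_def F_def Field_def by fastforce
    show "sym F" using symE by (auto simp: sym_def F_def)
    show "trans F" using closed symE transE unfolding trans_def F_def by blast
  qed
  moreover have "E \<subseteq> F" "(k, k) \<in> F" "\<forall>l \<in> set ls. (l, k) \<in> F"
    by (auto simp: F_def A_def)
  ultimately have "esub (To ls k) E \<subseteq> F" by (auto simp: esub_def)
  then show ?thesis using xy by (auto simp: F_def)
qed


lemma Hasco_subset_Htrn: "Hasco H \<subseteq> Htrn H"
  by (auto simp: Hasco_def Htrn_def)

text \<open>A committed name cannot lie in the collapsed class: it is not the fresh
  \<open>k\<close>, it does not occur in \<open>P\<close> and so is not in \<open>ls\<close>, and by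
  liveness everything related to a member of \<open>ls\<close> is active rather than
  committed.\<close>

lemma merge_frozen:
  assumes live: "live (E, H, P)" and ls: "set ls \<subseteq> ftn P" and k: "k \<notin> trn_env E H"
    and l: "l \<in> Hasco H" and lx: "(ExT l, x) \<in> esub (To ls k) E"
  shows "(ExT l, x) \<in> E"
proof (rule ccontr)
  assume "(ExT l, x) \<notin> E"
  moreover have config: "config (E, H, P)" using live by (rule live_config)
  moreover have "equiv (Field E) E" "k \<notin> Field E"
    using config_equiv[OF config] k by (auto simp: trn_env_def)
  ultimately have "ExT l = k \<or> ExT l \<in> set ls \<or> (\<exists>l' \<in> set ls. (l', ExT l) \<in> E)"
    using esub_cases lx by fastforce
  moreover have "ExT l \<noteq> k" using k l Hasco_subset_Htrn[of H] by (auto simp: trn_env_def)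
  moreover have "ExT l \<notin> set ls" using config_ftn_Hasco[OF config] ls l by blast
  moreover have "(l', ExT l) \<notin> E" if "l' \<in> set ls" for l'
    using live_active[OF live] config_active_not_Hasco[OF config] that ls l by blast
  ultimately show False by blast
qed

text \<open>The collapsed class consists of \<open>k\<close>, of occurring names and of their
  relatives, and liveness makes the external ones other than \<open>k\<close> active. This is what
  preserves liveness under a merge.\<close>

lemma merge_active:
  assumes live: "live (E, H, P)" and ls: "set ls \<subseteq> ftn P" and k: "k \<notin> trn_env E H"
    and l: "l \<in> insert k (ftn P)" and lx: "(l, ExT k') \<in> esub (To ls k) E"
  shows "ExT k' = k \<or> (\<exists>i a. H i = Some (k', StAct a))"
proof -
  have config: "config (E, H, P)" using live by (rule live_config)
  have E: "equiv (Field E) E" and kE: "k \<notin> Field E"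
    using config_equiv[OF config] k by (auto simp: trn_env_def)
  consider "(l, ExT k') \<in> E" | "ExT k' = k" | "ExT k' \<in> set ls"
    | l' where "l' \<in> set ls" "(l', ExT k') \<in> E"
    using esub_cases[OF E kE lx] by blast
  then show ?thesis
  proof cases
    case 1
    then have "l \<noteq> k" using kE by (auto intro: FieldI1)
    then show ?thesis using 1 l live_active[OF live] by blast
  next
    case 3
    \<comment> \<open>An occurring external name is in the history, hence related to itself, so
      liveness applies with the name as its own relative.\<close>
    then have "ExT k' \<in> ftn P" using ls by blast
    moreover from this have "(ExT k', ExT k') \<in> E"
      using config_Htrn_iff[OF config] config_ftn_Htrn[OF config] by blast
    ultimately show ?thesis using live_active[OF live] by blast
  next
    case 4
    then show ?thesis using ls live_active[OF live] by blast
  qed blast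
qed

section \<open>Committing and aborting a class\<close>

lemma settle_eq_StCo:
  "settle s E H k i = Some (l, StCo) \<longleftrightarrow>
     H i = Some (l, StCo) \<or> s = StCo \<and> (ExT l, k) \<in> E \<and> (\<exists>a. H i = Some (l, StAct a))"
proof (cases "H i")
  case (Some e)
  obtain l' t where "e = (l', t)" by fastforce
  with Some show ?thesis by (cases t) (auto simp: settle_def)
qed (simp add: settle_def)

lemma Hasco_settle_StAb: "Hasco (settle StAb E H k) = Hasco H"
  by (simp add: Hasco_def settle_eq_StCo)

text \<open>\<open>settle\<close> rewrites only active entries. Since \<open>k\<close> occurs in
  \<open>P\<close>, liveness makes every external name of its class active, so all of them become
  committed and none was committed before.\<close>

lemma Hasco_settle_StCo:
  assumes live: "live (E, H, P)" and k: "k \<in> ftn P"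
  shows "Hasco (settle StCo E H k) = Hasco H \<union> Eext E k"
    and "Hasco H \<inter> Eext E k = {}"
proof -
  have config: "config (E, H, P)" using live by (rule live_config)
  have active: "\<exists>i a. H i = Some (l, StAct a)" if "l \<in> Eext E k" for l
    using live_active[OF live k] that by (simp add: Eext_def)
  then show "Hasco H \<inter> Eext E k = {}" using config_active_not_Hasco[OF config] by blast
  have "l \<in> Eext E k \<longleftrightarrow> (ExT l, k) \<in> E" for l
    using config_sym[OF config] unfolding Eext_def by blast
  then show "Hasco (settle StCo E H k) = Hasco H \<union> Eext E k"
    using active by (simp add: Hasco_def settle_eq_StCo set_eq_iff) blast
qed

lemma Htrn_settle: "Htrn (settle s E H k) = Htrn H"
proof (rule set_eqI)
  have "(\<exists>t. settle s E H k i = Some (l, t)) \<longleftrightarrow> (\<exists>t. H i = Some (l, t))" for i l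
    by (auto simp: settle_def split: option.splits status.splits)
  then show "l \<in> Htrn (settle s E H k) \<longleftrightarrow> l \<in> Htrn H" for l by (simp add: Htrn_def)
qed

lemma Hasco_upd: "i \<notin> dom H \<Longrightarrow> s \<noteq> StCo \<Longrightarrow> Hasco (H(i \<mapsto> (k, s))) = Hasco H"
  by (auto simp: Hasco_def split: if_splits)

text \<open>Distinct occurring names lie in distinct classes and \<open>k\<close> itself vanishes,
  so no name left in \<open>Q\<close> belongs to the settled class, and the entries that liveness
  requires to be active are untouched.\<close>

lemma live_settle:
  assumes live: "live (E, H, P)" and r: "rtrans P \<beta> Q" "\<beta> = CoL k \<or> \<beta> = AbL k"
    and config': "config (E, settle s E H k, Q)"
  shows "live (E, settle s E H k, Q)"
proof -
  have config: "config (E, H, P)" using live by (rule live_config)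
  have k: "k \<in> ftn P" and Q: "ftn Q \<subseteq> ftn P - {k}"
    using rtrans_settle_ftn[OF r process_nameless_runs[OF config_process[OF config]]] by auto
  have "\<exists>i a. settle s E H k i = Some (k', StAct a)" if l: "l \<in> ftn Q" "(l, ExT k') \<in> E" for l k'
  proof -
    obtain i a where i: "H i = Some (k', StAct a)" using live_active[OF live] l Q by blast
    have "(ExT k', k) \<notin> E"
    proof
      assume "(ExT k', k) \<in> E"
      then have "(l, k) \<in> E" using l config_trans[OF config] by blast
      then have "l = k" using config_ftn_eq[OF config] l(1) Q k by blast
      then show False using l Q by blast
    qed
    then have "settle s E H k i = Some (k', StAct a)" using i by (simp add: settle_def)
    then show ?thesis by blast
  qed
  then show ?thesis using config' by (rule liveI[rotated])
qed

section \<open>Evolution of live configurations\<close>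

definition joined :: "('n, 'i, 'e) conf \<Rightarrow> 'e \<Rightarrow> 'e \<Rightarrow> bool" where
  "joined C k k' \<longleftrightarrow> (ExT k, ExT k') \<in> fst C"

text \<open>What persists along transitions. The last conjunct freezes the classes of committed
  names, so that a relation observed at the end of a run can be pulled back to the moment of the
  commit.\<close>

definition evolves :: "('n, 'i, 'e) conf \<Rightarrow> ('n, 'i, 'e) conf \<Rightarrow> bool" where
  "evolves C C' \<longleftrightarrow> live C' \<and> conf_hasco C \<subseteq> conf_hasco C' \<and>
     (\<forall>k k'. joined C k k' \<longrightarrow> joined C' k k') \<and>
     (\<forall>k \<in> conf_hasco C. \<forall>k'. joined C' k k' \<longrightarrow> joined C k k')"

lemma evolves_live: "evolves C C' \<Longrightarrow> live C'"
  by (simp add: evolves_def)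

lemma evolves_hasco: "evolves C C' \<Longrightarrow> conf_hasco C \<subseteq> conf_hasco C'"
  by (simp add: evolves_def)

lemma evolves_joined: "evolves C C' \<Longrightarrow> joined C k k' \<Longrightarrow> joined C' k k'"
  by (simp add: evolves_def)

lemma evolves_joined_iff:
  "evolves C C' \<Longrightarrow> k \<in> conf_hasco C \<Longrightarrow> joined C' k k' \<longleftrightarrow> joined C k k'"
  unfolding evolves_def by blast

lemma evolves_refl: "live C \<Longrightarrow> evolves C C"
  by (simp add: evolves_def)

lemma evolves_trans: "evolves C C' \<Longrightarrow> evolves C' C'' \<Longrightarrow> evolves C C''"
  unfolding evolves_def by blast

lemma live_joined_hasco:
  "live (C :: ('n, 'i, 'e) conf) \<Longrightarrow> joined C k k' \<Longrightarrow> k \<in> conf_hasco C \<longleftrightarrow> k' \<in> conf_hasco C"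
  using live_config[of C] config_Hasco_iff by (cases C) (fastforce simp: joined_def)

lemma live_joined_sym: "live C \<Longrightarrow> joined C k k' \<Longrightarrow> joined C k' k"
  using config_sym[OF live_config] by (cases C) (simp add: joined_def)

text \<open>Common to merges under an internal name, where \<open>H'\<close> is \<open>H\<close>,
  and under an external one, where \<open>H'\<close> also records the new action. The last premise
  covers the fresh name, about which liveness of the source says nothing.\<close>

lemma evolves_merge:
  assumes live: "live (E, H, P)" and k: "k \<notin> trn_env E H"
    and tr: "ptrans P (At k \<mu>) \<sigma> Q" and config': "config (esub \<sigma> E, H', Q)"
    and H': "\<And>j e. H j = Some e \<Longrightarrow> H' j = Some e" "Hasco H' = Hasco H"
    and new: "\<And>k'. k = ExT k' \<Longrightarrow> \<exists>i a. H' i = Some (k', StAct a)"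
  shows "evolves (E, H, P) (esub \<sigma> E, H', Q)"
proof -
  obtain ls where \<sigma>: "\<sigma> = To ls k" using ptrans_range[OF tr] by blast
  then have ls: "set ls \<subseteq> ftn P" and Q: "ftn Q \<subseteq> insert k (ftn P)"
    using ptrans_ftn[OF tr] by auto
  have "live (esub \<sigma> E, H', Q)"
  proof (rule liveI[OF config'])
    fix l k' assume "l \<in> ftn Q" "(l, ExT k') \<in> esub \<sigma> E"
    then have "ExT k' = k \<or> (\<exists>i a. H i = Some (k', StAct a))"
      using merge_active[OF live ls k] Q unfolding \<sigma> by blast
    then show "\<exists>i a. H' i = Some (k', StAct a)" using new H'(1) by blast
  qed
  then show ?thesis
    using merge_frozen[OF live ls k] H'(2) by (auto simp: evolves_def joined_def esub_mono \<sigma>)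
qed

lemma evolves_settle:
  assumes live: "live (E, H, P)" and r: "rtrans P \<beta> Q"
    and \<beta>: "\<beta> = CoL k \<and> s = StCo \<or> \<beta> = AbL k \<and> s = StAb"
    and config': "config (E, settle s E H k, Q)"
  shows "evolves (E, H, P) (E, settle s E H k, Q)"
proof -
  have "live (E, settle s E H k, Q)" using live_settle[OF live r _ config'] \<beta> by blast
  moreover have "k \<in> ftn P"
    using rtrans_settle_ftn[OF r, of k] \<beta>
      process_nameless_runs[OF config_process[OF live_config[OF live]]] by blast
  then have "Hasco H \<subseteq> Hasco (settle s E H k)"
    using \<beta> by (auto simp: Hasco_settle_StAb Hasco_settle_StCo(1)[OF live])
  ultimately show ?thesis by (auto simp: evolves_def joined_def)
qed

lemma live_shrink: "live (E, H, P) \<Longrightarrow> config (E, H, Q) \<Longrightarrow> ftn Q \<subseteq> ftn P \<Longrightarrow> live (E, H, Q)"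
  by (rule liveI) (auto dest: live_active)

lemma xtrans_evolves:
  assumes "xtrans SysE \<zeta> C C'" and live: "live C"
  shows "evolves C C'"
proof -
  have "xrule SysE C \<zeta> C'" and config': "config C'" using assms(1) by (auto simp: xtrans_def)
  then show ?thesis using live
  proof cases
    case (tau P Q E H)
    then have "live (E, H, Q)"
      using ptrans_ftn[OF tau(4)] live_shrink[of E H P Q] live config' by simp
    then show ?thesis using tau by (simp add: evolves_def joined_def)
  next
    case (ttau P k \<sigma> Q E H)
    show ?thesis unfolding ttau
      by (rule evolves_merge[OF _ ttau(5,4)]) (use ttau live config' in auto)
  next
    case (new P k Q E H)
    have "live (E, H, Q)"
    proof (rule liveI)
      show "config (E, H, Q)" using new config' by simp
    next
      fix l k' assume l: "l \<in> ftn Q" "(l, ExT k') \<in> E"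
      \<comment> \<open>\<open>l\<close> has a relative in \<open>E\<close>, so it differs from the
        fresh name given to the started transaction.\<close>
      then have "l \<in> ftn P" using rtrans_new_ftn[OF new(4)] new(5) by (auto simp: trn_env_def Field_def)
      then show "\<exists>i a. H i = Some (k', StAct a)" using live_active[of E H P l k'] l(2) live new(1) by simp
    qed
    then show ?thesis using new by (simp add: evolves_def joined_def)
  next
    case (coE P k Q E H)
    then show ?thesis using evolves_settle[of E H P "CoL k" Q k StCo] live config' by simp
  next
    case (ab P k Q E H)
    then show ?thesis using evolves_settle[of E H P "AbL k" Q k StAb] live config' by simp
  next
    case (act P k a \<sigma> Q E H i)
    show ?thesis unfolding act
      by (rule evolves_merge[OF _ act(5,4)]) (use act live config' in \<open>auto simp: Hasco_upd\<close>)
  next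
    case (env k E H P i a)
    have "ExT k \<notin> Field E" using env by (simp add: trn_env_def)
    moreover have "k \<notin> Hasco H" using env Hasco_subset_Htrn[of H] by (auto simp: trn_env_def)
    moreover have "live (insert (ExT k, ExT k) E, H(i \<mapsto> (k, StAb)), P)"
      (is "live (?E, ?H, _)")
    proof (rule liveI)
      show "config (?E, ?H, P)" using config' env by simp
    next
      \<comment> \<open>The added class is the singleton of an aborted name that does not occur in
        \<open>P\<close>; it imposes no new demand of activity.\<close>
      fix l k' assume "l \<in> ftn P" "(l, ExT k') \<in> ?E"
      then obtain j b where "H j = Some (k', StAct b)"
        using live_active[of E H P l k'] live env by auto
      moreover from this have "?H j = Some (k', StAct b)" using env by auto
      ultimately show "\<exists>i a. ?H i = Some (k', StAct a)" by blast
    qed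
    ultimately show ?thesis using env by (auto simp: evolves_def joined_def Hasco_upd)
  qed simp_all
qed


section \<open>Commits and commit-sensitive transitions\<close>

lemma xtrans_SysE_cases:
  assumes "xtrans SysE \<zeta> C C'"
  obtains "\<zeta> = XTau" | k a where "\<zeta> = XAct k a"
proof -
  have "xrule SysE C \<zeta> C'" using assms by (simp add: xtrans_def)
  then show ?thesis by cases (use that in auto)
qed

lemma xtrans_XAct_sys:
  assumes "xtrans s (XAct k a) C C'"
  shows "xtrans s' (XAct k a) C C'"
proof -
  have "xrule s C (XAct k a) C'" using assms by (simp add: xtrans_def)
  then have "xrule s' C (XAct k a) C'" by cases (auto intro: xrule.act xrule.env)
  then show ?thesis using assms by (simp add: xtrans_def)
qed

lemma xtrans_XAct_hasco:
  assumes "xtrans s (XAct k a) C C'"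
  shows "conf_hasco C' = conf_hasco C"
proof -
  have "xrule s C (XAct k a) C'" using assms by (simp add: xtrans_def)
  then show ?thesis by cases (auto simp: Hasco_upd)
qed

lemma live_commit:
  assumes live: "live (E, H, P)" and r: "rtrans P (CoL k) Q"
  shows "Hasco (settle StCo E H k) = Hasco H \<union> Eext E k"
    and "Hasco H \<inter> Eext E k = {}"
    and "l \<in> Eext E k \<Longrightarrow> l' \<in> Eext E k \<Longrightarrow> (ExT l, ExT l') \<in> E"
proof -
  have config: "config (E, H, P)" using live by (rule live_config)
  have "k \<in> ftn P"
    using rtrans_settle_ftn[OF r, of k] process_nameless_runs[OF config_process[OF config]] by blast
  then show "Hasco (settle StCo E H k) = Hasco H \<union> Eext E k" "Hasco H \<inter> Eext E k = {}"
    using Hasco_settle_StCo[OF live] by blast+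
  show "(ExT l, ExT l') \<in> E" if "l \<in> Eext E k" "l' \<in> Eext E k"
    using that config_sym[OF config] config_trans[OF config] unfolding Eext_def by blast
qed

text \<open>The systems differ only in the commit rules. By liveness the label of a commit is
  exactly the set of newly committed names, so the growth of \<open>conf_hasco\<close> tells which
  commit-sensitive step an internal step is.\<close>

lemma xtrans_SysE_XTau_cases:
  assumes x: "xtrans SysE XTau C C'" and live: "live C"
  obtains (quiet) "xtrans SysC XTau C C'" "conf_hasco C' = conf_hasco C"
  | (commit) K where "xtrans SysC (XCo K) C C'" "K \<noteq> {}" "conf_hasco C' = conf_hasco C \<union> K"
      "conf_hasco C \<inter> K = {}" "\<And>k k'. k \<in> K \<Longrightarrow> k' \<in> K \<Longrightarrow> joined C k k'"
proof -
  have cfg: "config C" "config C'" and "xrule SysE C XTau C'" using x by (auto simp: xtrans_def)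
  from this(3) show ?thesis
  proof cases
    case (coE P k Q E H)
    then have r: "rtrans P (CoL k) Q" and C: "C = (E, H, P)" "C' = (E, settle StCo E H k, Q)"
      by auto
    note commit = live_commit[OF live[unfolded C] r]
    show ?thesis
    proof (cases "Eext E k = {}")
      case True
      show ?thesis
      proof (rule quiet)
        show "xtrans SysC XTau C C'"
          using cfg r True unfolding C xtrans_def by (auto intro: xrule.coCtau)
        show "conf_hasco C' = conf_hasco C" using commit(1) True C by simp
      qed
    next
      case False
      show ?thesis
      proof (rule that(2))
        show "xtrans SysC (XCo (Eext E k)) C C'"
          using cfg r False unfolding C xtrans_def by (auto intro: xrule.coC)
        show "conf_hasco C' = conf_hasco C \<union> Eext E k" "conf_hasco C \<inter> Eext E k = {}"
          using commit C by simp_all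
        show "joined C l l'" if "l \<in> Eext E k" "l' \<in> Eext E k" for l l'
          using commit(3) that C by (simp add: joined_def)
      qed (rule False)
    qed
  qed (use quiet cfg in \<open>auto simp: xtrans_def Hasco_settle_StAb intro: xrule.intros\<close>)
qed

lemma xtrans_SysC_XTau:
  assumes x: "xtrans SysC XTau C C'" and live: "live C"
  shows "xtrans SysE XTau C C' \<and> conf_hasco C' = conf_hasco C"
proof -
  have cfg: "config C" "config C'" and "xrule SysC C XTau C'" using x by (auto simp: xtrans_def)
  from this(3) show ?thesis
  proof cases
    case (coCtau P k Q E H)
    then show ?thesis
      using cfg live live_commit(1)[of E H P k Q]
      by (auto simp: xtrans_def intro: xrule.coE)
  qed (use cfg in \<open>auto simp: xtrans_def Hasco_settle_StAb intro: xrule.intros\<close>)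
qed

lemma xtrans_SysC_XCo:
  assumes x: "xtrans SysC (XCo K) C C'" and live: "live C"
  shows "xtrans SysE XTau C C' \<and> K \<noteq> {} \<and> conf_hasco C' = conf_hasco C \<union> K \<and>
    conf_hasco C \<inter> K = {} \<and> (\<forall>k \<in> K. \<forall>k' \<in> K. joined C k k')"
proof -
  have cfg: "config C" "config C'" and "xrule SysC C (XCo K) C'" using x by (auto simp: xtrans_def)
  from this(3) show ?thesis
  proof cases
    case (coC P k Q E H)
    then show ?thesis
      using cfg live live_commit[of E H P k Q]
      by (auto simp: xtrans_def joined_def intro: xrule.coE)
  qed
qed

text \<open>An external name in the field of \<open>E\<close> or in the process is already in the
  history. Freshness thus survives internal steps, which change the status of history entries but
  not their names.\<close>

lemma config_xfresh: "config (E, H, P) \<Longrightarrow> xfresh (XAct k a) (E, H, P) \<longleftrightarrow> k \<notin> Htrn H"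
  using config_Htrn_iff[of E H P k] config_ftn_Htrn[of E H P k] config_equiv[of E H P]
  by (auto simp: trn_env_def equiv_def refl_on_def)

lemma xtrans_XTau_fresh:
  assumes x: "xtrans s XTau C C'" and fresh: "xfresh (XAct k a) C"
  shows "xfresh (XAct k a) C'"
proof -
  have cfg: "config C" "config C'" and "xrule s C XTau C'" using x by (auto simp: xtrans_def)
  from this(3) have "Htrn (fst (snd C')) = Htrn (fst (snd C))" by cases (auto simp: Htrn_settle)
  then show ?thesis using cfg fresh by (cases C; cases C') (simp add: config_xfresh del: xfresh.simps)
qed

section \<open>Weak transitions\<close>

lemma weak_XTau: "weak s XTau = (xtrans s XTau)\<^sup>*\<^sup>*"
  by (simp add: weak_def)

lemma weak_compose:
  "weak s XTau C D \<Longrightarrow> weak s \<zeta> D D' \<Longrightarrow> weak s XTau D' C' \<Longrightarrow> weak s \<zeta> C C'"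
  unfolding weak_def relcompp_apply by (cases "\<zeta> = XTau"; simp; meson rtranclp_trans)

lemma weak_refl: "weak s XTau C C"
  by (simp add: weak_XTau)

lemma weak_step: "xtrans s \<zeta> C C' \<Longrightarrow> weak s \<zeta> C C'"
  unfolding weak_def by auto

lemma weak_split:
  assumes "weak s \<zeta> C C'" "\<zeta> \<noteq> XTau"
  obtains D D' where "weak s XTau C D" "xtrans s \<zeta> D D'" "weak s XTau D' C'"
  using assms unfolding weak_def by (auto elim!: relcomppE)

lemma weak_XTau_induct [consumes 1, case_names refl step]:
  assumes "weak s XTau C C'"
    and "R C'"
    and "\<And>C D. xtrans s XTau C D \<Longrightarrow> weak s XTau D C' \<Longrightarrow> R D \<Longrightarrow> R C"
  shows "R C"
  using assms(1) unfolding weak_XTau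
proof (induction rule: converse_rtranclp_induct)
  case base
  show ?case by (rule assms(2))
next
  case (step C D)
  show ?case by (rule assms(3)[OF step(1) _ step(3)]) (use step(2) in \<open>simp add: weak_XTau\<close>)
qed

lemma weak_XTau_fresh: "weak s XTau C C' \<Longrightarrow> xfresh (XAct k a) C \<Longrightarrow> xfresh (XAct k a) C'"
  by (induction rule: weak_XTau_induct) (auto dest: xtrans_XTau_fresh)

text \<open>Matching single steps suffices. Answering the internal steps before a visible one keeps
  its name fresh on the answering side, so the single-step premise still applies there.\<close>

lemma weak_simulation:
  assumes sim: "\<And>C1 C2 \<zeta> C1'. R C1 C2 \<Longrightarrow> xtrans s \<zeta> C1 C1' \<Longrightarrow>
      (\<And>k a. \<zeta> = XAct k a \<Longrightarrow> xfresh \<zeta> C2) \<Longrightarrow> \<exists>C2'. weak s \<zeta> C2 C2' \<and> R C1' C2'"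
    and R: "R C1 C2" and w: "weak s \<zeta> C1 C1'"
    and fresh: "\<And>k a. \<zeta> = XAct k a \<Longrightarrow> xfresh \<zeta> C2"
  shows "\<exists>C2'. weak s \<zeta> C2 C2' \<and> R C1' C2'"
proof -
  have tau: "\<exists>D'. weak s XTau D D' \<and> R C' D'" if "weak s XTau C C'" "R C D" for C C' D
    using that
  proof (induction arbitrary: D rule: weak_XTau_induct)
    case refl
    then show ?case using weak_refl by blast
  next
    case (step C C1)
    then obtain D1 where "weak s XTau D D1" "R C1 D1" using sim[of C D XTau C1] by auto
    then show ?case using step.IH weak_compose weak_refl by blast
  qed
  show ?thesis
  proof (cases "\<zeta> = XTau")
    case True
    then show ?thesis using tau w R by blast
  next
    case False
    with w obtain D1 D1' where 1: "weak s XTau C1 D1" "xtrans s \<zeta> D1 D1'" "weak s XTau D1' C1'"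
      by (rule weak_split)
    obtain D2 where 2: "weak s XTau C2 D2" "R D1 D2" using tau 1(1) R by blast
    have "xfresh \<zeta> D2" if "\<zeta> = XAct k a" for k a
      using fresh weak_XTau_fresh[OF 2(1)] that by blast
    then obtain D2' where 3: "weak s \<zeta> D2 D2'" "R D1' D2'" using sim 2(2) 1(2) by blast
    obtain C2' where "weak s XTau D2' C2'" "R C1' C2'" using tau 1(3) 3(2) by blast
    then show ?thesis using weak_compose 2(1) 3(1) by blast
  qed
qed

lemma half_transferI:
  assumes "\<And>C1 C2 \<zeta> C1'. R C1 C2 \<Longrightarrow> xtrans s \<zeta> C1 C1' \<Longrightarrow>
      (\<And>k a. \<zeta> = XAct k a \<Longrightarrow> xfresh \<zeta> C2) \<Longrightarrow> \<exists>C2'. weak s \<zeta> C2 C2' \<and> R C1' C2'"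
  shows "half_transfer s R"
  unfolding half_transfer_def
proof (intro allI impI, elim conjE)
  fix C1 C2 \<zeta> C1'
  assume "R C1 C2" "weak s \<zeta> C1 C1'" "xfresh \<zeta> C2"
  then show "\<exists>C2'. weak s \<zeta> C2 C2' \<and> R C1' C2'"
    by (intro weak_simulation[of R s C1 C2 \<zeta> C1']) (rule assms)
qed

text \<open>The premise is that of \<open>half_transferI\<close> for \<open>SysC\<close>, so one
  simulation argument yields both properties.\<close>

lemma half_commit_transferI:
  assumes "\<And>C1 C2 \<zeta> C1'. R C1 C2 \<Longrightarrow> xtrans SysC \<zeta> C1 C1' \<Longrightarrow>
      (\<And>k a. \<zeta> = XAct k a \<Longrightarrow> xfresh \<zeta> C2) \<Longrightarrow> \<exists>C2'. weak SysC \<zeta> C2 C2' \<and> R C1' C2'"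
  shows "half_commit_transfer R"
  unfolding half_commit_transfer_def
proof (intro allI impI, elim conjE)
  fix C1 C2 K C1'
  assume "R C1 C2" "weak SysC (XCo K) C1 C1'"
  then show "\<exists>C2'. weak SysC (XCo K) C2 C2' \<and> R C1' C2'"
    by (intro weak_simulation[of R SysC C1 C2 "XCo K" C1']) (rule assms, auto)
qed

section \<open>Weak transitions of the two systems compared\<close>

lemma weak_evolves:
  assumes "weak SysE \<zeta> C C'" "live C"
  shows "evolves C C'"
proof -
  have tau: "evolves C C'" if "weak SysE XTau C C'" "live C" for C C'
    using that
  proof (induction rule: weak_XTau_induct)
    case refl
    then show ?case by (rule evolves_refl)
  next
    case (step C D)
    have "evolves C D" using step.hyps(1) step.prems by (rule xtrans_evolves)
    then show ?case using step.IH evolves_live evolves_trans by blast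
  qed
  show ?thesis
  proof (cases "\<zeta> = XTau")
    case True
    then show ?thesis using tau assms by blast
  next
    case False
    with assms(1) obtain D D'
      where D: "weak SysE XTau C D" "xtrans SysE \<zeta> D D'" "weak SysE XTau D' C'"
      by (rule weak_split)
    have 1: "evolves C D" using D(1) assms(2) by (rule tau)
    have 2: "evolves D D'" using D(2) evolves_live[OF 1] by (rule xtrans_evolves)
    have 3: "evolves D' C'" using D(3) evolves_live[OF 2] by (rule tau)
    show ?thesis using 1 2 3 evolves_trans by blast
  qed
qed

lemma weak_SysC_XTau:
  "weak SysC XTau C C' \<Longrightarrow> live C \<Longrightarrow> weak SysE XTau C C' \<and> conf_hasco C' = conf_hasco C"
proof (induction rule: weak_XTau_induct)
  case refl
  then show ?case by (simp add: weak_refl)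
next
  case (step C D)
  then have CD: "xtrans SysE XTau C D" "conf_hasco D = conf_hasco C"
    using xtrans_SysC_XTau by blast+
  then have "live D" using evolves_live[OF xtrans_evolves] step.prems by blast
  then show ?case using step.IH CD weak_step weak_compose weak_refl by metis
qed

text \<open>The committed set only grows along a run. If it agrees at both ends it is constant, and
  no step can then be a commit with a nonempty label.\<close>

lemma weak_SysE_XTau_quiet:
  "weak SysE XTau C C' \<Longrightarrow> live C \<Longrightarrow> conf_hasco C' = conf_hasco C \<Longrightarrow> weak SysC XTau C C'"
proof (induction rule: weak_XTau_induct)
  case refl
  then show ?case by (simp add: weak_refl)
next
  case (step C D)
  have CD: "evolves C D" using step.hyps(1) step.prems(1) by (rule xtrans_evolves)
  then have "live D" by (rule evolves_live)
  moreover have "evolves D C'" using step.hyps(2) \<open>live D\<close> by (rule weak_evolves)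
  ultimately have D: "live D" "conf_hasco D = conf_hasco C"
    using evolves_hasco[OF CD] evolves_hasco[of D C'] step.prems(2) by auto
  from step(1,4) have "xtrans SysC XTau C D"
    by (cases rule: xtrans_SysE_XTau_cases) (use D in auto)
  moreover have "weak SysC XTau D C'" using step.IH D step.prems(2) by simp
  ultimately show ?case using weak_compose[OF weak_refl weak_step] by blast
qed

lemma weak_SysC_XAct:
  assumes "weak SysC (XAct k a) C C'" "live C"
  shows "weak SysE (XAct k a) C C' \<and> conf_hasco C' = conf_hasco C"
proof -
  obtain D D' where D: "weak SysC XTau C D" "xtrans SysC (XAct k a) D D'" "weak SysC XTau D' C'"
    using assms(1) by (rule weak_split) simp
  have CD: "weak SysE XTau C D" "conf_hasco D = conf_hasco C" using weak_SysC_XTau D(1) assms(2) by blast+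
  have DD: "xtrans SysE (XAct k a) D D'" using D(2) by (rule xtrans_XAct_sys)
  have "live D'"
    using evolves_live[OF xtrans_evolves[OF DD]] evolves_live[OF weak_evolves[OF CD(1)]] assms(2)
    by blast
  then have "weak SysE XTau D' C'" "conf_hasco C' = conf_hasco D'" using weak_SysC_XTau D(3) by blast+
  then show ?thesis using CD weak_step[OF DD] xtrans_XAct_hasco[OF DD] weak_compose by metis
qed

lemma weak_SysE_XAct_quiet:
  assumes "weak SysE (XAct k a) C C'" "live C" "conf_hasco C' = conf_hasco C"
  shows "weak SysC (XAct k a) C C'"
proof -
  obtain D D' where D: "weak SysE XTau C D" "xtrans SysE (XAct k a) D D'" "weak SysE XTau D' C'"
    using assms(1) by (rule weak_split) simp
  have 1: "evolves C D" using D(1) assms(2) by (rule weak_evolves)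
  have 2: "evolves D D'" using D(2) evolves_live[OF 1] by (rule xtrans_evolves)
  have 3: "evolves D' C'" using D(3) evolves_live[OF 2] by (rule weak_evolves)
  have "conf_hasco D = conf_hasco C" "conf_hasco C' = conf_hasco D'"
    using evolves_hasco[OF 1] evolves_hasco[OF 2] evolves_hasco[OF 3] assms(3) by auto
  then have "weak SysC XTau C D" "weak SysC XTau D' C'"
    using weak_SysE_XTau_quiet D(1,3) assms(2) evolves_live[OF 2] by blast+
  moreover have "weak SysC (XAct k a) D D'" using weak_step[OF xtrans_XAct_sys[OF D(2)]] .
  ultimately show ?thesis using weak_compose by blast
qed

lemma weak_SysC_XCo:
  assumes "weak SysC (XCo K) C C'" "live C"
  shows "weak SysE XTau C C' \<and> conf_hasco C' = conf_hasco C \<union> K"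
proof -
  obtain D D' where D: "weak SysC XTau C D" "xtrans SysC (XCo K) D D'" "weak SysC XTau D' C'"
    using assms(1) by (rule weak_split) simp
  have CD: "weak SysE XTau C D" "conf_hasco D = conf_hasco C" using weak_SysC_XTau D(1) assms(2) by blast+
  then have "live D" using evolves_live[OF weak_evolves] assms(2) by blast
  then have DD: "xtrans SysE XTau D D'" "conf_hasco D' = conf_hasco D \<union> K"
    using xtrans_SysC_XCo[OF D(2)] by blast+
  have "live D'" using xtrans_evolves[OF DD(1) \<open>live D\<close>] by (rule evolves_live)
  then have "weak SysE XTau D' C'" "conf_hasco C' = conf_hasco D'" using weak_SysC_XTau D(3) by blast+
  then show ?thesis using CD weak_step[OF DD(1)] DD(2) weak_compose by metis
qed

text \<open>The names committed along a weak transition commit in a single step as soon as they end up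
  joined, because the class of a committed name no longer grows.\<close>

lemma weak_SysE_XTau_commit:
  assumes "weak SysE XTau C C'" "live C" "conf_hasco C' = conf_hasco C \<union> K" "K \<noteq> {}"
    and "conf_hasco C \<inter> K = {}" "\<And>k k'. k \<in> K \<Longrightarrow> k' \<in> K \<Longrightarrow> joined C' k k'"
  shows "weak SysC (XCo K) C C'"
  using assms
proof (induction rule: weak_XTau_induct)
  case refl
  then show ?case by blast
next
  case (step C D)
  have CD: "evolves C D" using step.hyps(1) step.prems(1) by (rule xtrans_evolves)
  then have live_D: "live D" by (rule evolves_live)
  have DC': "evolves D C'" using step.hyps(2) live_D by (rule weak_evolves)
  from step.hyps(1) step.prems(1) show ?case
  proof (cases rule: xtrans_SysE_XTau_cases)
    case quiet
    then have "weak SysC (XCo K) D C'" using step.IH step.prems live_D by simp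
    then show ?thesis using quiet weak_step weak_compose weak_refl by blast
  next
    case (commit L)
    have "conf_hasco D \<subseteq> conf_hasco C'" using DC' by (rule evolves_hasco)
    then have "L \<subseteq> K" using commit step.prems by auto
    \<comment> \<open>Some \<open>l\<close> in \<open>L\<close> is committed at \<open>D\<close>, so
      its class is frozen from there: being joined to \<open>k\<close> at \<open>C'\<close> it is
      joined to \<open>k\<close> at \<open>D\<close>. Joined names share commit status, so
      \<open>k\<close> is committed by this very step.\<close>
    moreover have "k \<in> L" if "k \<in> K" for k
    proof -
      obtain l where l: "l \<in> L" using commit by blast
      then have "joined C' l k" using \<open>L \<subseteq> K\<close> that step.prems(5) by blast
      then have "joined D l k" using evolves_joined_iff[OF DC'] l commit(3) by blast
      then have "k \<in> conf_hasco D" using live_joined_hasco[OF live_D] l commit(3) by blast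
      then show ?thesis using commit(3) that step.prems(4) by blast
    qed
    ultimately have "L = K" by blast
    \<comment> \<open>All of \<open>K\<close> is committed at \<open>D\<close>, so the rest of the
      run is quiet.\<close>
    moreover from this have "weak SysC XTau D C'"
      using weak_SysE_XTau_quiet[OF step.hyps(2) live_D] commit(3) step.prems(2) by simp
    ultimately show ?thesis using commit(1) weak_step weak_compose weak_refl by blast
  qed
qed

text \<open>Consider the first step after which \<open>k\<close> or \<open>k'\<close> is committed.
  If only one of them is, its target is the separating \<open>D\<close>; if both are, a single
  commit did it, so they were already joined, and joined names stay joined.\<close>

lemma weak_SysE_XTau_pair:
  assumes "weak SysE XTau C C'" "live C" "k \<notin> conf_hasco C" "k' \<notin> conf_hasco C"
    and "k \<in> conf_hasco C'" "k' \<in> conf_hasco C'"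
  shows "joined C' k k' \<or> (\<exists>D. weak SysE XTau C D \<and> (k \<in> conf_hasco D) \<noteq> (k' \<in> conf_hasco D))"
  using assms
proof (induction rule: weak_XTau_induct)
  case refl
  then show ?case by blast
next
  case (step C D)
  have CD: "evolves C D" using step.hyps(1) step.prems(1) by (rule xtrans_evolves)
  then have live_D: "live D" by (rule evolves_live)
  have DC': "evolves D C'" using step.hyps(2) live_D by (rule weak_evolves)
  consider "k \<notin> conf_hasco D" "k' \<notin> conf_hasco D" | "(k \<in> conf_hasco D) \<noteq> (k' \<in> conf_hasco D)"
    | "k \<in> conf_hasco D" "k' \<in> conf_hasco D" by blast
  then show ?case
  proof cases
    case 1
    then show ?thesis
      using step.IH live_D step.prems weak_compose[OF weak_step[OF step.hyps(1)] _ weak_refl] by blast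
  next
    case 2
    then show ?thesis using weak_step step.hyps(1) by blast
  next
    case 3
    have "joined C k k'"
      using step.hyps(1) step.prems(1)
      by (cases rule: xtrans_SysE_XTau_cases) (use 3 step.prems in auto)
    then show ?thesis using evolves_joined[OF DC' evolves_joined[OF CD]] by blast
  qed
qed

section \<open>The equivalences\<close>

lemma live_init: "config ({}, H, P) \<Longrightarrow> live ({}, H, P)"
  by (simp add: live_def)

lemma sat_eqco_iff:
  "sat_eqco C k k' \<longleftrightarrow> k \<in> conf_hasco C \<and> k' \<in> conf_hasco C \<and> joined C k k'"
  by (cases C) (auto simp: joined_def)

lemma largest_sym:
  assumes "\<And>R. bis R \<Longrightarrow> bis R\<inverse>\<inverse>" "largest bis C1 C2"
  shows "largest bis C2 C1"
  using assms unfolding largest_def by (metis conversepI)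

lemma hasco_bisim_conversep: "hasco_bisim R \<Longrightarrow> hasco_bisim R\<inverse>\<inverse>"
  unfolding hasco_bisim_def on_configs_def transfer_def conversep_iff conversep_conversep by metis

lemma eq_bisim_conversep: "eq_bisim R \<Longrightarrow> eq_bisim R\<inverse>\<inverse>"
  unfolding eq_bisim_def on_configs_def transfer_def conversep_iff conversep_conversep by metis

lemma canco_bisim_conversep: "canco_bisim R \<Longrightarrow> canco_bisim R\<inverse>\<inverse>"
  unfolding canco_bisim_def on_configs_def transfer_def conversep_iff conversep_conversep by metis

lemma transferD:
  assumes "transfer s R" "R C1 C2" "\<zeta> = XTau \<or> (\<exists>k a. \<zeta> = XAct k a)" "weak s \<zeta> C1 C1'"
    and "\<And>k a. \<zeta> = XAct k a \<Longrightarrow> xfresh \<zeta> C2"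
  shows "\<exists>C2'. weak s \<zeta> C2 C2' \<and> R C1' C2'"
proof -
  have "xfresh \<zeta> C2" using assms(3,5) by (cases C2) auto
  then show ?thesis using assms unfolding transfer_def half_transfer_def by blast
qed

lemma symp_conversep_eq: "(\<And>C1 C2. R C1 C2 \<Longrightarrow> R C2 C1) \<Longrightarrow> R\<inverse>\<inverse> = R"
  by (intro ext) auto

text \<open>The committed names are the diagonal of \<open>sat_eqco\<close>, since every name in the
  history is related to itself.\<close>

lemma eq_imp_hasco:
  fixes R :: "('n, 'i, 'e) crel"
  assumes "eq_bisim R"
  shows "hasco_bisim R"
proof -
  have "conf_hasco C1 = conf_hasco C2" if "R C1 C2" for C1 C2
  proof -
    have cfg: "config C1" "config C2" and "\<forall>k k'. sat_eqco C1 k k' \<longleftrightarrow> sat_eqco C2 k k'"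
      using assms that unfolding eq_bisim_def on_configs_def by blast+
    moreover have "sat_eqco C k k \<longleftrightarrow> k \<in> conf_hasco C" if "config C" for C :: "('n, 'i, 'e) conf" and k
      using that config_Htrn_iff Hasco_subset_Htrn by (cases C) fastforce
    ultimately show ?thesis by blast
  qed
  then show ?thesis using assms by (simp add: eq_bisim_def hasco_bisim_def)
qed

text \<open>\<open>Hasco\<close>-bisimilarity does not record how previously committed names are
  related, so agreement on \<open>sat_eqco\<close> is carried as an invariant of \<open>R\<close>.
  Old classes keep it by freezing; new ones by excluding separate commits on the answering
  side.\<close>

lemma hasco_imp_eq:
  fixes C1 C2 :: "('n, 'i, 'e) conf"
  assumes "largest hasco_bisim C1 C2" "live C1" "live C2"
    and "\<And>k k'. sat_eqco C1 k k' \<longleftrightarrow> sat_eqco C2 k k'"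
  shows "largest eq_bisim C1 C2"
proof -
  let ?B = "largest hasco_bisim :: ('n, 'i, 'e) crel"
  define R :: "('n, 'i, 'e) crel" where "R = (\<lambda>C1 C2. ?B C1 C2 \<and> live C1 \<and> live C2 \<and>
    (\<forall>k k'. sat_eqco C1 k k' \<longleftrightarrow> sat_eqco C2 k k'))"
  have transfer: "transfer SysE ?B"
    and B_hasco: "\<And>C1 C2. ?B C1 C2 \<Longrightarrow> conf_hasco C1 = conf_hasco C2"
    using hasco_bisim_largest unfolding hasco_bisim_def by blast+
  have B_sym: "?B C2 C1" if "?B C1 C2" for C1 C2
    using that by (rule largest_sym[rotated]) (rule hasco_bisim_conversep)
  have "half_transfer SysE R"
  proof (rule half_transferI)
    fix C1 C2 C1' :: "('n, 'i, 'e) conf" and \<zeta> :: "('n, 'e) xlab"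
    assume R: "R C1 C2" and x: "xtrans SysE \<zeta> C1 C1'"
      and fresh: "\<And>k a. \<zeta> = XAct k a \<Longrightarrow> xfresh \<zeta> C2"
    have B: "?B C1 C2" and live: "live C1" "live C2"
      and sat: "\<And>k k'. sat_eqco C1 k k' \<longleftrightarrow> sat_eqco C2 k k'"
      using R by (auto simp: R_def)
    have "\<zeta> = XTau \<or> (\<exists>k a. \<zeta> = XAct k a)" using x by (cases rule: xtrans_SysE_cases) auto
    then obtain C2' where w: "weak SysE \<zeta> C2 C2'" and B': "?B C1' C2'"
      using transferD[OF transfer B _ weak_step[OF x]] fresh by blast
    have ev: "evolves C1 C1'" "evolves C2 C2'"
      using xtrans_evolves[OF x live(1)] weak_evolves[OF w live(2)] .
    then have live': "live C1'" "live C2'" by (auto intro: evolves_live)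
    note H = B_hasco[OF B] B_hasco[OF B']
    \<comment> \<open>For a frozen \<open>k\<close> both sides reduce to the configurations before
      the step. There anything joined to \<open>k\<close> is itself committed, so
      \<open>joined\<close> coincides with \<open>sat_eqco\<close>.\<close>
    have old: "joined C1' k k' \<longleftrightarrow> joined C2' k k'" if k: "k \<in> conf_hasco C1" for k k'
    proof -
      have "joined C1' k k' \<longleftrightarrow> joined C1 k k'" "joined C2' k k' \<longleftrightarrow> joined C2 k k'"
        using evolves_joined_iff[OF ev(1) k] evolves_joined_iff[OF ev(2)] k H by auto
      moreover have "joined C1 k k' \<longleftrightarrow> joined C2 k k'"
        using live_joined_hasco[OF live(1), of k k'] live_joined_hasco[OF live(2), of k k']
          sat[of k k'] k H by (auto simp: sat_eqco_iff)
      ultimately show ?thesis by blast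
    qed
    have new: "joined C1' k k' \<and> joined C2' k k'"
      if k: "k \<in> conf_hasco C1'" "k' \<in> conf_hasco C1'" "k \<notin> conf_hasco C1" "k' \<notin> conf_hasco C1"
      for k k'
    proof -
      \<comment> \<open>Only an internal step can commit names; committing both at once, it must
        find them joined already in \<open>C1\<close>.\<close>
      have "\<zeta> \<noteq> XAct l a" for l a using k x xtrans_XAct_hasco[of SysE l a C1 C1'] by metis
      with x have tau: "\<zeta> = XTau" by (cases rule: xtrans_SysE_cases) blast+
      from x[unfolded tau] live(1) have j: "joined C1 k k'"
        by (cases rule: xtrans_SysE_XTau_cases) (use k in auto)
      \<comment> \<open>\<open>C1\<close> has to match a run to \<open>D\<close>, but after any such
        run \<open>k\<close> and \<open>k'\<close> are still joined and hence share their commit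
        status. So \<open>weak_SysE_XTau_pair\<close> leaves only its first alternative.\<close>
      have "(k \<in> conf_hasco D) = (k' \<in> conf_hasco D)" if D: "weak SysE XTau C2 D" for D
      proof -
        obtain D1 where D1: "weak SysE XTau C1 D1" "?B D D1"
          using transferD[OF transfer B_sym[OF B] _ D] by blast
        have "evolves C1 D1" using D1(1) live(1) by (rule weak_evolves)
        then have "live D1" "joined D1 k k'" using j by (auto intro: evolves_live evolves_joined)
        then show ?thesis using live_joined_hasco[of D1 k k'] B_hasco[OF D1(2)] by simp
      qed
      then have "joined C2' k k'"
        using weak_SysE_XTau_pair[OF w[unfolded tau] live(2)] k H by blast
      then show ?thesis using evolves_joined[OF ev(1) j] by blast
    qed
    have "sat_eqco C1' k k' \<longleftrightarrow> sat_eqco C2' k k'" for k k'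
      using old[of k k'] old[of k' k] new[of k k'] H live_joined_sym[OF live'(1)]
        live_joined_sym[OF live'(2)] unfolding sat_eqco_iff by blast
    then show "\<exists>C2'. weak SysE \<zeta> C2 C2' \<and> R C1' C2'" using w B' live' unfolding R_def by blast
  qed
  moreover have "R\<inverse>\<inverse> = R" by (rule symp_conversep_eq) (auto simp: R_def B_sym)
  ultimately have "eq_bisim R"
    by (auto simp: eq_bisim_def on_configs_def transfer_def R_def live_config)
  moreover have "R C1 C2" using assms by (simp add: R_def)
  ultimately show ?thesis by (auto simp: largest_def)
qed

text \<open>A commit-sensitive step is read as an extended step and answered there. Both sides then
  have the same committed set, and its growth determines the label with which the answer is read
  back.\<close>

lemma eq_imp_canco:
  fixes C1 C2 :: "('n, 'i, 'e) conf"
  assumes "largest eq_bisim C1 C2" "live C1" "live C2"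
  shows "largest canco_bisim C1 C2"
proof -
  let ?B = "largest eq_bisim :: ('n, 'i, 'e) crel"
  define R :: "('n, 'i, 'e) crel" where "R = (\<lambda>C1 C2. ?B C1 C2 \<and> live C1 \<and> live C2)"
  have transfer: "transfer SysE ?B"
    and B_sat: "\<And>C1 C2 k k'. ?B C1 C2 \<Longrightarrow> sat_eqco C1 k k' \<longleftrightarrow> sat_eqco C2 k k'"
    using eq_bisim_largest unfolding eq_bisim_def by blast+
  have B_hasco: "conf_hasco C1 = conf_hasco C2" if "?B C1 C2" for C1 C2
    using eq_imp_hasco[OF eq_bisim_largest] that unfolding hasco_bisim_def by blast
  have B_sym: "?B C2 C1" if "?B C1 C2" for C1 C2
    using that by (rule largest_sym[rotated]) (rule eq_bisim_conversep)
  have sim: "\<exists>C2'. weak SysC \<zeta> C2 C2' \<and> R C1' C2'"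
    if R: "R C1 C2" and x: "xtrans SysC \<zeta> C1 C1'"
      and fresh: "\<And>k a. \<zeta> = XAct k a \<Longrightarrow> xfresh \<zeta> C2" for C1 C2 \<zeta> C1'
  proof -
    have B: "?B C1 C2" and live: "live C1" "live C2" using R by (auto simp: R_def)
    have answer: "\<exists>C2'. weak SysE \<xi> C2 C2' \<and> R C1' C2' \<and> conf_hasco C2' = conf_hasco C1'"
      if y: "xtrans SysE \<xi> C1 C1'" and fresh: "\<And>k a. \<xi> = XAct k a \<Longrightarrow> xfresh \<xi> C2" for \<xi>
    proof -
      have "\<xi> = XTau \<or> (\<exists>k a. \<xi> = XAct k a)" using y by (cases rule: xtrans_SysE_cases) auto
      then obtain C2' where w: "weak SysE \<xi> C2 C2'" "?B C1' C2'"
        using transferD[OF transfer B _ weak_step[OF y]] fresh by blast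
      moreover have "live C1'" "live C2'"
        using xtrans_evolves[OF y live(1)] weak_evolves[OF w(1) live(2)] by (auto intro: evolves_live)
      ultimately show ?thesis using B_hasco[OF w(2)] unfolding R_def by metis
    qed
    show ?thesis
    proof (cases \<zeta>)
      case XTau
      then have y: "xtrans SysE XTau C1 C1'" "conf_hasco C1' = conf_hasco C1"
        using xtrans_SysC_XTau x live(1) by blast+
      obtain C2' where w: "weak SysE XTau C2 C2'" "R C1' C2'" "conf_hasco C2' = conf_hasco C1'"
        using answer[OF y(1)] by auto
      have "weak SysC XTau C2 C2'"
        using weak_SysE_XTau_quiet[OF w(1) live(2)] w(3) y(2) B_hasco[OF B] by simp
      then show ?thesis using w(2) XTau by blast
    next
      case (XAct k a)
      have y: "xtrans SysE (XAct k a) C1 C1'" "conf_hasco C1' = conf_hasco C1"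
        using xtrans_XAct_sys[OF x[unfolded XAct]] xtrans_XAct_hasco[OF x[unfolded XAct]] .
      obtain C2' where w: "weak SysE (XAct k a) C2 C2'" "R C1' C2'" "conf_hasco C2' = conf_hasco C1'"
        using answer[OF y(1)] fresh XAct by blast
      have "weak SysC (XAct k a) C2 C2'"
        using weak_SysE_XAct_quiet[OF w(1) live(2)] w(3) y(2) B_hasco[OF B] by simp
      then show ?thesis using w(2) XAct by blast
    next
      case (XCo K)
      then have y: "xtrans SysE XTau C1 C1'" and K: "K \<noteq> {}" "conf_hasco C1' = conf_hasco C1 \<union> K"
        "conf_hasco C1 \<inter> K = {}" "\<And>k k'. k \<in> K \<Longrightarrow> k' \<in> K \<Longrightarrow> joined C1 k k'"
        using xtrans_SysC_XCo[of K C1 C1'] x live(1) by auto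
      obtain C2' where w: "weak SysE XTau C2 C2'" "R C1' C2'" "conf_hasco C2' = conf_hasco C1'"
        using answer[OF y] by auto
      \<comment> \<open>Equal committed sets do not exclude an answer committing \<open>K\<close> in
        several steps. The names of \<open>K\<close> are committed together at \<open>C1'\<close>,
        and the \<open>Eq\<close> condition transfers this to \<open>C2'\<close>, as
        \<open>weak_SysE_XTau_commit\<close> requires.\<close>
      have "joined C2' k k'" if k: "k \<in> K" "k' \<in> K" for k k'
      proof -
        have "joined C1' k k'"
          using evolves_joined[OF xtrans_evolves[OF y live(1)] K(4)[OF k]] .
        then have "sat_eqco C1' k k'" using k K(2) by (simp add: sat_eqco_iff)
        then show ?thesis using B_sat[of C1' C2' k k'] w(2) by (simp add: R_def sat_eqco_iff)
      qed
      then have "weak SysC (XCo K) C2 C2'"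
        using weak_SysE_XTau_commit[OF w(1) live(2), of K] w(3) K B_hasco[OF B] by simp
      then show ?thesis using w(2) XCo by blast
    qed
  qed
  have "half_transfer SysC R" by (rule half_transferI) (rule sim)
  moreover have "half_commit_transfer R" by (rule half_commit_transferI) (rule sim)
  moreover have "R\<inverse>\<inverse> = R" by (rule symp_conversep_eq) (auto simp: R_def B_sym)
  ultimately have "canco_bisim R"
    by (auto simp: canco_bisim_def on_configs_def transfer_def R_def live_config)
  moreover have "R C1 C2" using assms by (simp add: R_def)
  ultimately show ?thesis by (auto simp: largest_def)
qed

text \<open>Commit-sensitive bisimilarity observes only the names committed from now on, so equality
  of the committed sets is carried as an invariant: matching labels make both sets grow by the same
  \<open>K\<close>, or not at all.\<close>

lemma canco_imp_hasco:
  fixes C1 C2 :: "('n, 'i, 'e) conf"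
  assumes "largest canco_bisim C1 C2" "live C1" "live C2" "conf_hasco C1 = conf_hasco C2"
  shows "largest hasco_bisim C1 C2"
proof -
  let ?B = "largest canco_bisim :: ('n, 'i, 'e) crel"
  define R :: "('n, 'i, 'e) crel" where
    "R = (\<lambda>C1 C2. ?B C1 C2 \<and> live C1 \<and> live C2 \<and> conf_hasco C1 = conf_hasco C2)"
  have transfer: "transfer SysC ?B" and commit: "half_commit_transfer ?B"
    using canco_bisim_largest unfolding canco_bisim_def by blast+
  have B_sym: "?B C2 C1" if "?B C1 C2" for C1 C2
    using that by (rule largest_sym[rotated]) (rule canco_bisim_conversep)
  have "half_transfer SysE R"
  proof (rule half_transferI)
    fix C1 C2 C1' :: "('n, 'i, 'e) conf" and \<zeta> :: "('n, 'e) xlab"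
    assume R: "R C1 C2" and x: "xtrans SysE \<zeta> C1 C1'"
      and fresh: "\<And>k a. \<zeta> = XAct k a \<Longrightarrow> xfresh \<zeta> C2"
    have B: "?B C1 C2" and live: "live C1" "live C2" and H: "conf_hasco C1 = conf_hasco C2"
      using R by (auto simp: R_def)
    have "\<exists>C2'. weak SysE \<zeta> C2 C2' \<and> ?B C1' C2' \<and> conf_hasco C1' = conf_hasco C2'"
      using x
    proof (cases rule: xtrans_SysE_cases)
      case 1
      from x[unfolded 1] live(1) show ?thesis
      proof (cases rule: xtrans_SysE_XTau_cases)
        case quiet
        obtain C2' where "weak SysC XTau C2 C2'" "?B C1' C2'"
          using transferD[OF transfer B _ weak_step[OF quiet(1)]] by blast
        then show ?thesis using weak_SysC_XTau live(2) quiet(2) H 1 by metis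
      next
        case (commit K)
        obtain C2' where "weak SysC (XCo K) C2 C2'" "?B C1' C2'"
          using \<open>half_commit_transfer ?B\<close> B weak_step[OF commit(1)]
          unfolding half_commit_transfer_def by blast
        then show ?thesis using weak_SysC_XCo live(2) commit(3) H 1 by metis
      qed
    next
      case (2 k a)
      have y: "xtrans SysC (XAct k a) C1 C1'" "conf_hasco C1' = conf_hasco C1"
        using xtrans_XAct_sys[OF x[unfolded 2]] xtrans_XAct_hasco[OF x[unfolded 2]] .
      obtain C2' where "weak SysC (XAct k a) C2 C2'" "?B C1' C2'"
        using transferD[OF transfer B _ weak_step[OF y(1)]] fresh 2 by blast
      then show ?thesis using weak_SysC_XAct live(2) y(2) H 2 by metis
    qed
    then obtain C2' where w: "weak SysE \<zeta> C2 C2'" "?B C1' C2'" "conf_hasco C1' = conf_hasco C2'"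
      by blast
    moreover have "live C1'" "live C2'"
      using xtrans_evolves[OF x live(1)] weak_evolves[OF w(1) live(2)] by (auto intro: evolves_live)
    ultimately show "\<exists>C2'. weak SysE \<zeta> C2 C2' \<and> R C1' C2'" unfolding R_def by blast
  qed
  moreover have "R\<inverse>\<inverse> = R" by (rule symp_conversep_eq) (auto simp: R_def B_sym)
  ultimately have "hasco_bisim R"
    by (auto simp: hasco_bisim_def on_configs_def transfer_def R_def live_config)
  moreover have "R C1 C2" using assms by (simp add: R_def)
  ultimately show ?thesis by (auto simp: largest_def)
qed

theorem corollary5p7:
  assumes "infinite (UNIV :: 'n set)"
    and "infinite (UNIV :: 'i set)"
    and "infinite (UNIV :: 'e set)"
  shows "((\<approx>\<^bsub>Hasco\<^esub>) :: ('n, 'i, 'e) proc \<Rightarrow> ('n, 'i, 'e) proc \<Rightarrow> bool) = (\<approx>\<^bsub>Eq\<^esub>)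
    \<and> ((\<approx>\<^bsub>Eq\<^esub>) :: ('n, 'i, 'e) proc \<Rightarrow> ('n, 'i, 'e) proc \<Rightarrow> bool) = (\<approx>\<^bsub>Canco\<^esub>)"
proof -
  have live: "live ({}, Map.empty, P) \<and> live ({}, Map.empty, Q)"
    if "on_configs B" "on_procs B P Q" for B and P Q :: "('n, 'i, 'e) proc"
    using that by (simp add: on_configs_def on_procs_def live_init)
  have configs: "on_configs (largest hasco_bisim :: ('n, 'i, 'e) crel)"
    "on_configs (largest eq_bisim :: ('n, 'i, 'e) crel)"
    "on_configs (largest canco_bisim :: ('n, 'i, 'e) crel)"
    using hasco_bisim_largest eq_bisim_largest canco_bisim_largest
    unfolding hasco_bisim_def eq_bisim_def canco_bisim_def by blast+
  \<comment> \<open>The three inclusions form a cycle. The agreement premises of the first and third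
    hold because the empty history commits nothing, and liveness holds because the initial relation
    is empty.\<close>
  have "P \<approx>\<^bsub>Hasco\<^esub> Q \<Longrightarrow> P \<approx>\<^bsub>Eq\<^esub> Q" for P Q :: "('n, 'i, 'e) proc"
    using live[OF configs(1), of P Q] hasco_imp_eq[of "({}, Map.empty, P)" "({}, Map.empty, Q)"]
    by (simp add: approx_Hasco_def approx_Eq_def on_procs_def)
  moreover have "P \<approx>\<^bsub>Eq\<^esub> Q \<Longrightarrow> P \<approx>\<^bsub>Canco\<^esub> Q" for P Q :: "('n, 'i, 'e) proc"
    using live[OF configs(2), of P Q] eq_imp_canco[of "({}, Map.empty, P)" "({}, Map.empty, Q)"]
    by (simp add: approx_Eq_def approx_Canco_def on_procs_def)
  moreover have "P \<approx>\<^bsub>Canco\<^esub> Q \<Longrightarrow> P \<approx>\<^bsub>Hasco\<^esub> Q" for P Q :: "('n, 'i, 'e) proc"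
    using live[OF configs(3), of P Q] canco_imp_hasco[of "({}, Map.empty, P)" "({}, Map.empty, Q)"]
    by (simp add: approx_Canco_def approx_Hasco_def on_procs_def)
  ultimately show ?thesis by (intro conjI ext) blast+
qed

end
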